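(* Let $d\geqslant 2$ and let $\Omega\subset\mathbb{R}^d$ be a convex body (compact convex set with nonempty interior) whose boundary $\partial\Omega$ is smooth with finite order of contact at every point, regarded as a subset of the torus $\mathbb{T}^d=\mathbb{R}^d/\mathbb{Z}^d$. Then there exists a constant $c>0$ (depending only on $\Omega$) such that for every $N\geqslant 1$ and every choice of $N$ points $z_1,\ldots,z_N\in\mathbb{T}^d$, \[ \int_{\mathbb{T}^{d}}\int_{0}^{1}\left|\sum_{j=1}^{N}\chi_{x+r\Omega}\left(z_{j}\right)-N r^d \left|\Omega\right|\right|^{2}dr\,dx\geqslant c\, N^{1-1/d}. \] In particular, for every choice of $N$ points $z_1,\ldots,z_N\in\mathbb{T}^d$ there exist $x\in\mathbb{T}^d$ and $r\in(0,1]$ such that \[ \left|\sum_{j=1}^{N}\chi_{x+r\Omega}\left(z_{j}\right)-N r^d \left|\Omega\right|\right|\geqslant c\, N^{1/2-1/(2d)}. \]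
   Context: $|\Omega|$ is the Lebesgue measure of $\Omega$, and for a set $K$, $\chi_K$ is its characteristic function; for $z\in\mathbb{T}^d$, $\chi_{x+r\Omega}(z)$ is understood periodically, i.e. as $\sum_{m\in\mathbb{Z}^d}\chi_{x+r\Omega}(z+m)$ (this is the indicator of the image of $x+r\Omega$ in $\mathbb{T}^d$ when that set fits in a fundamental domain). "Finite order of contact at every point" means: at each point of $\partial\Omega$, every one-dimensional line tangent to $\partial\Omega$ has finite order of contact with $\partial\Omega$. *)

theory Defs
  imports "HOL-Analysis.Analysis"
begin

text \<open>These are meant for open \<open>U\<close> only, since derivatives are taken at points, not within \<open>U\<close>.\<close>

fun Ck_on :: "nat \<Rightarrow> 'a::real_normed_vector set \<Rightarrow> ('a \<Rightarrow> 'b::real_normed_vector) \<Rightarrow> bool" where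
  "Ck_on 0 U f \<longleftrightarrow> continuous_on U f"
| "Ck_on (Suc k) U f \<longleftrightarrow>
     (\<forall>x\<in>U. f differentiable (at x)) \<and>
     (\<forall>v. Ck_on k U (\<lambda>x. frechet_derivative f (at x) v))"

definition smooth_on :: "'a::real_normed_vector set \<Rightarrow> ('a \<Rightarrow> 'b::real_normed_vector) \<Rightarrow> bool" where
  "smooth_on U f \<longleftrightarrow> (\<forall>k. Ck_on k U f)"

definition local_defining_function ::
    "'a::euclidean_space set \<Rightarrow> 'a \<Rightarrow> 'a set \<Rightarrow> ('a \<Rightarrow> real) \<Rightarrow> bool" where
  "local_defining_function S p U \<rho> \<longleftrightarrow>
     open U \<and> p \<in> U \<and> smooth_on U \<rho> \<and> S \<inter> U = {x \<in> U. \<rho> x = 0} \<and>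
     (\<forall>x \<in> S \<inter> U. \<exists>v. frechet_derivative \<rho> (at x) v \<noteq> 0)"

definition smooth_hypersurface :: "'a::euclidean_space set \<Rightarrow> bool" where
  "smooth_hypersurface S \<longleftrightarrow> (\<forall>p\<in>S. \<exists>U \<rho>. local_defining_function S p U \<rho>)"

text \<open>Tangency and order of contact are expressed through a local defining function; neither
  depends on which one is used, since two of them differ near \<open>p\<close> by a nonvanishing smooth factor.
  A tangent line is given by a point \<open>p\<close> of \<open>S\<close> and a nonzero direction \<open>v\<close>.\<close>

definition tangent_line :: "'a::euclidean_space set \<Rightarrow> 'a \<Rightarrow> 'a \<Rightarrow> bool" where
  "tangent_line S p v \<longleftrightarrow> p \<in> S \<and> v \<noteq> 0 \<and>
     (\<exists>U \<rho>. local_defining_function S p U \<rho> \<and> frechet_derivative \<rho> (at p) v = 0)"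

text \<open>The line through \<open>p\<close> in direction \<open>v\<close> has contact of order \<open>k\<close> with \<open>S\<close> at \<open>p\<close> if a defining
  function restricted to the line vanishes at \<open>p\<close> to order exactly \<open>k\<close>. In this normalisation
  tangent lines have order at least \<open>2\<close>; some authors subtract one, which does not affect
  finiteness.\<close>

definition has_contact_order :: "'a::euclidean_space set \<Rightarrow> 'a \<Rightarrow> 'a \<Rightarrow> nat \<Rightarrow> bool" where
  "has_contact_order S p v k \<longleftrightarrow>
     (\<exists>U \<rho>. local_defining_function S p U \<rho> \<and>
        (\<forall>j<k. (deriv ^^ j) (\<lambda>t::real. \<rho> (p + t *\<^sub>R v)) 0 = 0) \<and>
        (deriv ^^ k) (\<lambda>t::real. \<rho> (p + t *\<^sub>R v)) 0 \<noteq> 0)"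

definition finite_order_of_contact :: "'a::euclidean_space set \<Rightarrow> bool" where
  "finite_order_of_contact S \<longleftrightarrow>
     (\<forall>p v. tangent_line S p v \<longrightarrow> (\<exists>k. has_contact_order S p v k))"

definition convex_body :: "'a::euclidean_space set \<Rightarrow> bool" where
  "convex_body K \<longleftrightarrow> convex K \<and> compact K \<and> interior K \<noteq> {}"

text \<open>Points of the torus $\mathbb{R}^d/\mathbb{Z}^d$ are given by arbitrary representatives in
  $\mathbb{R}^d$, and functions on it by $\mathbb{Z}^d$-periodic functions, so that the integral over
  the torus is the integral over the unit cube.\<close>

definition integer_lattice :: "(real ^ 'n::finite) set" where
  "integer_lattice = {m. \<forall>i. m $ i \<in> \<int>}"

definition periodic_indicator :: "(real ^ 'n::finite) set \<Rightarrow> real ^ 'n \<Rightarrow> real" where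
  "periodic_indicator K z = (\<Sum>\<^sub>\<infinity>m\<in>integer_lattice. indicator K (z + m))"

definition scaled_copy :: "(real ^ 'n::finite) set \<Rightarrow> real ^ 'n \<Rightarrow> real \<Rightarrow> (real ^ 'n) set" where
  "scaled_copy \<Omega> x r = (\<lambda>w. x + r *\<^sub>R w) ` \<Omega>"

definition discrepancy ::
    "(real ^ 'n::finite) set \<Rightarrow> nat \<Rightarrow> (nat \<Rightarrow> real ^ 'n) \<Rightarrow> real ^ 'n \<Rightarrow> real \<Rightarrow> real" where
  "discrepancy \<Omega> N z x r =
     (\<Sum>j=1..N. periodic_indicator (scaled_copy \<Omega> x r) (z j))
       - real N * r ^ CARD('n) * measure lebesgue \<Omega>"

end

theory Submission
  imports Defs
begin

text \<open>For \<open>m \<noteq> 0\<close> the \<open>m\<close>-th Fourier coefficient of the discrepancy in \<open>x\<close> is the exponential sum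
  \<open>S m\<close> over the points times \<open>r ^ d\<close> times the Fourier transform of \<open>\<Omega>\<close> at \<open>r m\<close>. Pairing with
  \<open>r ^ (p - d) * (1 - r) ^ (p + 2) * cis (2 \<pi> (m \<bullet> x + \<beta> r))\<close> gives \<open>S m\<close> times the integral over \<open>\<Omega>\<close>
  of \<open>H (2 \<pi> (m \<bullet> w - \<beta>))\<close>, where \<open>H t\<close> is the Fourier integral of \<open>r ^ p * (1 - r) ^ (p + 2)\<close>. For
  \<open>p \<equiv> 3 (mod 4)\<close> the real part of \<open>H t\<close> behaves like \<open>p! / t ^ (p + 1)\<close>, so it is positive for
  \<open>t \<ge> T\<close>. Choosing \<open>\<beta>\<close> such that all of \<open>\<Omega>\<close> lies in this range, nothing cancels, and the integral is
  at least a constant times the volume of the cap of \<open>\<Omega>\<close> of height about \<open>1 / \<bar>m\<bar>\<close> in direction \<open>m\<close>.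
  A smooth boundary admits a uniform interior tangent ball, so this volume is at least a constant
  times \<open>\<bar>m\<bar> powr (- (d + 1) / 2)\<close>. Bessel's inequality together with the Cassels-Montgomery bound
  for the sum of \<open>\<bar>S m\<bar>\<^sup>2\<close> over \<open>0 < \<bar>m\<bar> \<lesssim> N powr (1 / d)\<close> yields the estimate.\<close>

section \<open>An oscillatory integral\<close>

text \<open>For one fixed radius the Fourier transform of \<open>\<Omega>\<close> at
  \<open>r m\<close> oscillates and can vanish, because the caps of \<open>\<Omega>\<close> in the
  directions \<open>m\<close> and \<open>- m\<close> interfere. The modulation by
  \<open>\<beta> r\<close> breaks this symmetry: up to the factor \<open>2 \<pi>\<close> and a shift
  by \<open>T\<close>, the argument of \<open>H\<close> becomes the height of \<open>w\<close> over
  the supporting plane of \<open>\<Omega>\<close> orthogonal to \<open>m\<close>. Near that plane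
  the real part of \<open>H\<close> has a fixed positive lower bound; elsewhere it is still
  nonnegative, so the rest of the body, including the far cap, can simply be discarded, and no
  asymptotic expansion of the Fourier transform is called for. Flatness of the boundary only
  enlarges caps, so what governs the weights is an upper bound on curvature, which an interior ball
  expresses. The shift \<open>\<beta>\<close> may vary with \<open>m\<close>, since integration in
  \<open>x\<close> alone makes the test functions orthogonal. The exponents balance at a cutoff
  \<open>K\<close> of order \<open>N powr (1 / d)\<close>: the exponential sums have total mass of
  order at least \<open>N K ^ d\<close>, each weight is at least of order
  \<open>1 / K ^ (d + 1)\<close>, and the product is of order \<open>N / K\<close>.\<close>

definition osc_integral :: "real poly \<Rightarrow> real \<Rightarrow> complex" where
  "osc_integral f t = (LINT s:{0..1}|lborel. poly f s *\<^sub>R cis (t * s))"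

lemma osc_integral_by_parts:
  assumes "t \<noteq> 0"
  shows "osc_integral f t =
    (\<i> / t) * (osc_integral (pderiv f) t + poly f 0 - poly f 1 * cis t)"
proof -
  let ?F = "\<lambda>s. poly f s *\<^sub>R cis (t * s)"
  let ?F1 = "\<lambda>s. poly (pderiv f) s *\<^sub>R cis (t * s)"
  let ?F2 = "\<lambda>s. (\<i> * t) * (poly f s *\<^sub>R cis (t * s))"
  have der: "(?F has_vector_derivative ?F1 s + ?F2 s) (at s within {0..1})" for s
  proof -
    have "(?F has_vector_derivative
        (poly f s *\<^sub>R (t *\<^sub>R (\<i> * cis (t * s))) + poly (pderiv f) s *\<^sub>R cis (t * s)))
        (at s within {0..1})"
    proof (rule has_vector_derivative_scaleR)
      show "(poly f has_field_derivative poly (pderiv f) s) (at s within {0..1})"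
        by (rule DERIV_subset[OF poly_DERIV]) simp
      have "((\<lambda>z. exp (\<i> * t * z)) has_field_derivative t *\<^sub>R (\<i> * cis (t * s)))
          (at (complex_of_real s))"
        by (auto intro!: derivative_eq_intros simp: cis_conv_exp scaleR_conv_of_real mult_ac)
      from has_vector_derivative_real_field[OF this]
      show "((\<lambda>s. cis (t * s)) has_vector_derivative t *\<^sub>R (\<i> * cis (t * s)))
          (at s within {0..1})"
        by (simp add: cis_conv_exp mult_ac)
    qed
    then show ?thesis by (simp add: scaleR_conv_of_real algebra_simps)
  qed
  have c1: "continuous_on {0..1} ?F1" and c2: "continuous_on {0..1} ?F2"
    by (auto intro!: continuous_intros)
  have "(\<integral>s. indicator {0..1} s *\<^sub>R (?F1 s + ?F2 s) \<partial>lborel) = ?F 1 - ?F 0"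
    using c1 c2 by (intro integral_FTC_atLeastAtMost der continuous_intros) auto
  moreover have "(LINT s:{0..1}|lborel. ?F1 s + ?F2 s)
      = (LINT s:{0..1}|lborel. ?F1 s) + (LINT s:{0..1}|lborel. ?F2 s)"
    using borel_integrable_atLeastAtMost'[OF c1] borel_integrable_atLeastAtMost'[OF c2]
    by (rule set_integral_add)
  moreover have "(LINT s:{0..1}|lborel. ?F2 s) = (\<i> * t) * osc_integral f t"
    unfolding osc_integral_def by (rule set_integral_mult_right)
  ultimately have "osc_integral (pderiv f) t + (\<i> * t) * osc_integral f t = ?F 1 - ?F 0"
    unfolding osc_integral_def set_lebesgue_integral_def by simp
  then have "(\<i> * t) * osc_integral f t
      = poly f 1 * cis t - poly f 0 - osc_integral (pderiv f) t"
    by (simp add: algebra_simps scaleR_conv_of_real)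
  then have "(\<i> / t) * ((\<i> * t) * osc_integral f t)
      = (\<i> / t) * (poly f 1 * cis t - poly f 0 - osc_integral (pderiv f) t)" by simp
  moreover have "(\<i> / t) * ((\<i> * t) * osc_integral f t) = - osc_integral f t"
    using assms by (simp add: field_simps)
  ultimately show ?thesis by (simp add: algebra_simps minus_equation_iff)
qed

lemma osc_integral_bounded: "\<exists>B. \<forall>t. norm (osc_integral f t) \<le> B"
proof (intro exI allI)
  fix t
  show "norm (osc_integral f t) \<le> (LINT s:{0..1}|lborel. \<bar>poly f s\<bar>)"
    using integral_norm_bound[of lborel "\<lambda>s. indicator {0..1} s *\<^sub>R (poly f s *\<^sub>R cis (t * s))"]
    by (simp add: osc_integral_def set_lebesgue_integral_def abs_mult)
qed

lemma osc_integral_decay: "\<exists>B. \<forall>t>0. norm (osc_integral f t) \<le> B / t"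
proof -
  obtain B where B: "\<And>t. norm (osc_integral (pderiv f) t) \<le> B"
    using osc_integral_bounded by blast
  show ?thesis
  proof (intro exI allI impI)
    fix t :: real assume t: "t > 0"
    have "norm (osc_integral (pderiv f) t + poly f 0 - poly f 1 * cis t)
       \<le> norm (osc_integral (pderiv f) t + poly f 0) + norm (poly f 1 * cis t)"
      by (rule norm_triangle_ineq4)
    also have "\<dots> \<le> norm (osc_integral (pderiv f) t) + norm (complex_of_real (poly f 0))
        + norm (poly f 1 * cis t)"
      by (intro add_mono norm_triangle_ineq order_refl)
    also have "\<dots> \<le> B + \<bar>poly f 0\<bar> + \<bar>poly f 1\<bar>"
      using B[of t] by (simp add: norm_mult)
    finally show "norm (osc_integral f t) \<le> (B + \<bar>poly f 0\<bar> + \<bar>poly f 1\<bar>) / t"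
      using t by (simp add: osc_integral_by_parts[of t f] norm_mult norm_divide divide_right_mono)
  qed
qed

lemma osc_integral_iterated_by_parts:
  assumes "t \<noteq> 0" "\<And>j. j < n \<Longrightarrow> poly ((pderiv ^^ j) f) 0 = 0"
    "\<And>j. j < n \<Longrightarrow> poly ((pderiv ^^ j) f) 1 = 0"
  shows "osc_integral f t = (\<i> / t) ^ n * osc_integral ((pderiv ^^ n) f) t"
  using assms(2,3)
proof (induction n)
  case (Suc n)
  have "osc_integral ((pderiv ^^ n) f) t = (\<i> / t) * osc_integral ((pderiv ^^ Suc n) f) t"
    using osc_integral_by_parts[OF assms(1), of "(pderiv ^^ n) f"] Suc.prems[of n] by simp
  then show ?case using Suc by (simp add: mult_ac)
qed simp

text \<open>Orders of vanishing are expressed through divisibility by powers of a linear factor, and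
  each derivative costs one power. This replaces explicit Leibniz expansions at the two end
  points.\<close>

lemma power_dvd_higher_pderiv:
  fixes a :: "real poly"
  shows "a ^ (n + j) dvd f \<Longrightarrow> a ^ n dvd (pderiv ^^ j) f"
proof (induction j arbitrary: n)
  case (Suc j)
  have "a ^ Suc n dvd (pderiv ^^ j) f" using Suc.IH[of "Suc n"] Suc.prems by simp
  then obtain h where "(pderiv ^^ j) f = a ^ Suc n * h" by (auto elim: dvdE)
  then have "(pderiv ^^ Suc j) f = a ^ n * (a * pderiv h + h * smult (of_nat (Suc n)) (pderiv a))"
    by (simp add: pderiv_mult pderiv_power_Suc algebra_simps del: power_Suc) (simp add: algebra_simps)
  then show ?case by simp
qed simp

text \<open>The zero at 0 fixes the order of the leading term and leaves room to divide by
  \<open>r ^ d\<close>. The zero at 1 has larger order, so the upper end point does not enter the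
  leading term.\<close>

definition bump_poly :: "nat \<Rightarrow> real poly" where
  "bump_poly p = monom 1 p * [:1, -1:] ^ (p + 2)"

lemma poly_bump_poly: "poly (bump_poly p) s = s ^ p * (1 - s) ^ (p + 2)"
proof -
  have "poly [:1, -1:] s = 1 - s" by simp
  then show ?thesis by (simp only: bump_poly_def poly_mult poly_monom poly_power)
qed

lemma bump_poly_vanish_0:
  assumes "j < p" shows "poly ((pderiv ^^ j) (bump_poly p)) 0 = 0"
proof -
  have "[:0, 1:] ^ (1 + j) dvd bump_poly p"
    unfolding bump_poly_def
    using assms by (intro dvd_mult2) (simp add: monom_altdef le_imp_power_dvd del: power_Suc)
  then have "[:0, 1:] ^ 1 dvd (pderiv ^^ j) (bump_poly p)" by (rule power_dvd_higher_pderiv)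
  then show ?thesis by (auto elim!: dvdE)
qed

lemma bump_poly_vanish_1:
  assumes "j < p + 2" shows "poly ((pderiv ^^ j) (bump_poly p)) 1 = 0"
proof -
  have "[:1, -1:] ^ (1 + j) dvd bump_poly p"
    unfolding bump_poly_def
    using assms by (intro dvd_mult le_imp_power_dvd) simp
  then have "[:1, -1:] ^ 1 dvd (pderiv ^^ j) (bump_poly p)" by (rule power_dvd_higher_pderiv)
  then show ?thesis by (auto elim!: dvdE)
qed

lemma bump_poly_deriv_0: "poly ((pderiv ^^ p) (bump_poly p)) 0 = fact p"
proof -
  have "coeff (bump_poly p) p = 1"
    by (simp add: bump_poly_def coeff_monom_mult coeff_0_power)
  then show ?thesis
    by (simp add: poly_0_coeff_0 coeff_higher_pderiv pochhammer_fact)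
qed

text \<open>The zero of order \<open>p\<close> at the lower end point produces the leading term
  \<open>p! (\<i> / t) ^ (p + 1)\<close>, which is positive because \<open>p + 1\<close> is a multiple of four.\<close>

lemma osc_integral_bump_poly_pos:
  assumes "p + 1 = 4 * (d::nat)"
  shows "\<exists>T>0. \<forall>t\<ge>T. Re (osc_integral (bump_poly p) t) \<ge> 1 / (2 * t ^ (p + 1))"
proof -
  obtain B where B: "\<And>t. t > 0 \<Longrightarrow> norm (osc_integral ((pderiv ^^ (p + 1)) (bump_poly p)) t) \<le> B / t"
    using osc_integral_decay by blast
  show ?thesis
  \<comment> \<open>Beyond this threshold the remainder \<open>B / t\<close> is at most 1/2 while
    \<open>fact p\<close> is at least 1, so a coefficient of at least 1/2 remains in front of
    \<open>1 / t ^ (p + 1)\<close>.\<close>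
  proof (intro exI[of _ "2 * \<bar>B\<bar> + 1"] conjI allI impI)
    fix t assume t: "2 * \<bar>B\<bar> + 1 \<le> t"
    then have t0: "t > 0" by linarith
    let ?g = "(pderiv ^^ p) (bump_poly p)"
    let ?h = "osc_integral ((pderiv ^^ (p + 1)) (bump_poly p)) t"
    have "osc_integral (bump_poly p) t = (\<i> / t) ^ p * osc_integral ?g t"
      using t0 by (intro osc_integral_iterated_by_parts bump_poly_vanish_0 bump_poly_vanish_1) auto
    also have "osc_integral ?g t = (\<i> / t) * (?h + fact p)"
      using osc_integral_by_parts[of t ?g] t0 bump_poly_vanish_1[of p p] bump_poly_deriv_0[of p]
      by simp
    finally have "osc_integral (bump_poly p) t = (\<i> / t) ^ (p + 1) * (?h + fact p)"
      by simp
    also have "(\<i> / t) ^ (p + 1) = complex_of_real (1 / t ^ (p + 1))"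
      unfolding power_divide assms by (simp add: power_mult)
    finally have "Re (osc_integral (bump_poly p) t) = (Re ?h + fact p) / t ^ (p + 1)"
      by (simp add: Re_divide_of_real flip: of_real_power)
    moreover have "\<bar>Re ?h\<bar> \<le> 1 / 2"
    proof -
      have "B / t \<le> 1 / 2" using t t0 by (simp add: field_simps)
      then show ?thesis using B[OF t0] abs_Re_le_cmod[of ?h] by linarith
    qed
    then have "1 / 2 \<le> Re ?h + fact p" using fact_ge_1[of p, where 'a=real] by linarith
    ultimately show "Re (osc_integral (bump_poly p) t) \<ge> 1 / (2 * t ^ (p + 1))"
      using t0 divide_right_mono[of "1/2" "Re ?h + fact p" "t ^ (p + 1)"] by simp
  qed linarith
qed

section \<open>Uniform interior balls\<close>

text \<open>The gradient is assembled from partial derivatives because \<open>Ck_on\<close> speaks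
  of \<open>frechet_derivative\<close> in one fixed direction at a time.\<close>

definition partial_gradient :: "('a::euclidean_space \<Rightarrow> real) \<Rightarrow> 'a \<Rightarrow> 'a" where
  "partial_gradient f x = (\<Sum>b\<in>Basis. frechet_derivative f (at x) b *\<^sub>R b)"

section \<open>Lipschitz gradients and second-order Taylor bounds\<close>

lemma frechet_derivative_eq_partial_gradient:
  fixes f :: "'a::euclidean_space \<Rightarrow> real"
  assumes "f differentiable (at x)"
  shows "frechet_derivative f (at x) v = partial_gradient f x \<bullet> v"
proof -
  have lin: "linear (frechet_derivative f (at x))"
    using assms by (rule linear_frechet_derivative)
  have "frechet_derivative f (at x) v = frechet_derivative f (at x) (\<Sum>b\<in>Basis. (v \<bullet> b) *\<^sub>R b)"
    by (simp only: euclidean_representation)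
  also have "\<dots> = (\<Sum>b\<in>Basis. (v \<bullet> b) *\<^sub>R frechet_derivative f (at x) b)"
    by (simp only: linear_sum[OF lin] linear_scale[OF lin])
  also have "\<dots> = partial_gradient f x \<bullet> v"
    by (simp add: partial_gradient_def inner_sum_left inner_commute[of v] mult.commute)
  finally show ?thesis .
qed

text \<open>Compactness bounds each partial derivative on the ball, the sum of these bounds controls
  the operator norm of the derivative, and convexity of the ball allows the mean value
  inequality.\<close>

lemma lipschitz_on_cball_of_continuous_partials:
  fixes g :: "'a::euclidean_space \<Rightarrow> real"
  assumes "cball p0 \<delta> \<subseteq> U" "\<And>x. x \<in> U \<Longrightarrow> g differentiable (at x)"
    and cont: "\<And>v. continuous_on U (\<lambda>x. frechet_derivative g (at x) v)"
  shows "\<exists>C\<ge>0. \<forall>x\<in>cball p0 \<delta>. \<forall>y\<in>cball p0 \<delta>. \<bar>g x - g y\<bar> \<le> C * norm (x - y)"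
proof -
  have "\<exists>K\<ge>0. \<forall>x\<in>cball p0 \<delta>. \<bar>frechet_derivative g (at x) b\<bar> \<le> K" for b
  proof -
    have "compact ((\<lambda>x. frechet_derivative g (at x) b) ` cball p0 \<delta>)"
      using continuous_on_subset[OF cont assms(1)] by (intro compact_continuous_image) auto
    then obtain K where "\<forall>x\<in>cball p0 \<delta>. \<bar>frechet_derivative g (at x) b\<bar> \<le> K"
      by (auto simp: bounded_iff dest!: compact_imp_bounded)
    then show ?thesis by (intro exI[of _ "max K 0"]) auto
  qed
  then obtain K where K: "\<And>b. K b \<ge> 0"
    "\<And>b x. x \<in> cball p0 \<delta> \<Longrightarrow> \<bar>frechet_derivative g (at x) b\<bar> \<le> K b"
    by metis
  have "norm (g x - g y) \<le> (\<Sum>b\<in>Basis. K b) * norm (x - y)"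
    if "x \<in> cball p0 \<delta>" "y \<in> cball p0 \<delta>" for x y
  proof (rule differentiable_bound[of "cball p0 \<delta>"])
    show "(g has_derivative frechet_derivative g (at x)) (at x within cball p0 \<delta>)"
      if "x \<in> cball p0 \<delta>" for x
      using assms that by (blast intro: frechet_derivative_works[THEN iffD1] has_derivative_at_withinI)
    show "onorm (frechet_derivative g (at x)) \<le> (\<Sum>b\<in>Basis. K b)" if x: "x \<in> cball p0 \<delta>" for x
    proof (rule onorm_bound)
      fix v
      have "g differentiable (at x)" using x assms by blast
      then have "norm (frechet_derivative g (at x) v)
          = \<bar>\<Sum>b\<in>Basis. frechet_derivative g (at x) b * (b \<bullet> v)\<bar>"
        by (simp add: frechet_derivative_eq_partial_gradient[of g x v] partial_gradient_def
            inner_sum_left)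
      also have "\<dots> \<le> (\<Sum>b\<in>Basis. \<bar>frechet_derivative g (at x) b * (b \<bullet> v)\<bar>)"
        by (rule sum_abs)
      also have "\<dots> \<le> (\<Sum>b\<in>Basis. K b * norm v)"
        unfolding abs_mult
        by (intro sum_mono mult_mono K x) (auto simp: Basis_le_norm inner_commute[of _ v] K)
      finally show "norm (frechet_derivative g (at x) v) \<le> (\<Sum>b\<in>Basis. K b) * norm v"
        by (simp add: sum_distrib_right)
    qed (simp add: sum_nonneg K)
  qed (use that in auto)
  then show ?thesis using K by (intro exI[of _ "\<Sum>b\<in>Basis. K b"]) (auto simp: sum_nonneg)
qed

lemma smooth_onD:
  assumes "smooth_on U f" "x \<in> U"
  shows "f differentiable (at x)"
    "(\<lambda>x. frechet_derivative f (at x) v) differentiable (at x)"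
  using assms(1)[unfolded smooth_on_def, rule_format, of 2] assms(2)
  by (simp_all add: numeral_2_eq_2)

lemma smooth_on_continuous_second_partials:
  assumes "smooth_on U f"
  shows "continuous_on U (\<lambda>x. frechet_derivative (\<lambda>x. frechet_derivative f (at x) v) (at x) w)"
  using assms[unfolded smooth_on_def, rule_format, of 2] by (simp add: numeral_2_eq_2)

lemma partial_gradient_lipschitz_on_cball:
  fixes f :: "'a::euclidean_space \<Rightarrow> real"
  assumes "cball p0 \<delta> \<subseteq> U" "smooth_on U f"
  shows "\<exists>C\<ge>0. \<forall>x\<in>cball p0 \<delta>. \<forall>y\<in>cball p0 \<delta>.
    norm (partial_gradient f x - partial_gradient f y) \<le> C * norm (x - y)"
proof -
  have "\<exists>C\<ge>0. \<forall>x\<in>cball p0 \<delta>. \<forall>y\<in>cball p0 \<delta>.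
      \<bar>frechet_derivative f (at x) b - frechet_derivative f (at y) b\<bar> \<le> C * norm (x - y)" for b
    by (rule lipschitz_on_cball_of_continuous_partials[OF assms(1)])
       (use assms in \<open>auto intro: smooth_onD smooth_on_continuous_second_partials\<close>)
  then obtain C where C: "\<And>b. C b \<ge> 0"
    "\<And>b x y. x\<in>cball p0 \<delta> \<Longrightarrow> y\<in>cball p0 \<delta> \<Longrightarrow>
      \<bar>frechet_derivative f (at x) b - frechet_derivative f (at y) b\<bar> \<le> C b * norm (x - y)"
    by metis
  show ?thesis
  proof (intro exI[of _ "\<Sum>b\<in>Basis. C b"] conjI ballI)
    fix x y assume xy: "x \<in> cball p0 \<delta>" "y \<in> cball p0 \<delta>"
    have "norm (partial_gradient f x - partial_gradient f y)
        = norm (\<Sum>b\<in>Basis. (frechet_derivative f (at x) b - frechet_derivative f (at y) b) *\<^sub>R b)"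
      by (simp add: partial_gradient_def sum_subtractf scaleR_diff_left)
    also have "\<dots> \<le> (\<Sum>b\<in>Basis. C b * norm (x - y))"
      by (rule order_trans[OF norm_sum sum_mono]) (use C(2)[OF xy] in simp)
    finally show "norm (partial_gradient f x - partial_gradient f y)
        \<le> (\<Sum>b\<in>Basis. C b) * norm (x - y)"
      by (simp add: sum_distrib_right)
  qed (simp add: sum_nonneg C)
qed

text \<open>By the mean value theorem on the segment, the increment of \<open>f\<close> is the
  gradient at an intermediate point applied to \<open>w - p\<close>. Replacing it by the gradient at
  \<open>p\<close> costs the Lipschitz constant times \<open>norm (w - p)\<close>, so
  \<open>C\<close> is that Lipschitz constant. It does not depend on the base point
  \<open>p\<close>, as the uniform radius below requires.\<close>

lemma smooth_on_taylor_cball: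
  fixes f :: "'a::euclidean_space \<Rightarrow> real"
  assumes "cball p0 \<delta> \<subseteq> U" "smooth_on U f"
  shows "\<exists>C\<ge>0. \<forall>p\<in>cball p0 \<delta>. \<forall>w\<in>cball p0 \<delta>.
    \<bar>f w - f p - partial_gradient f p \<bullet> (w - p)\<bar> \<le> C * (norm (w - p))\<^sup>2"
proof -
  obtain C where C: "C \<ge> 0" "\<And>x y. x\<in>cball p0 \<delta> \<Longrightarrow> y\<in>cball p0 \<delta> \<Longrightarrow>
      norm (partial_gradient f x - partial_gradient f y) \<le> C * norm (x - y)"
    using partial_gradient_lipschitz_on_cball[OF assms] by blast
  have "\<bar>f w - f p - partial_gradient f p \<bullet> (w - p)\<bar> \<le> C * (norm (w - p))\<^sup>2"
    if pw: "p\<in>cball p0 \<delta>" "w\<in>cball p0 \<delta>" for p w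
  proof -
    let ?l = "\<lambda>t::real. p + t *\<^sub>R (w - p)"
    have l: "?l t \<in> cball p0 \<delta>" if "0 \<le> t" "t \<le> 1" for t
      using convexD_alt[OF convex_cball pw that] by (simp add: algebra_simps)
    have "\<exists>t\<in>{0<..<1}. (f \<circ> ?l) 1 - (f \<circ> ?l) 0 =
        (frechet_derivative f (at (?l t)) \<circ> (\<lambda>h. h *\<^sub>R (w - p))) (1 - 0)"
    proof (rule mvt_simple)
      fix t :: real assume t: "0 \<le> t" "t \<le> 1"
      have "(f has_derivative frechet_derivative f (at (?l t))) (at (?l t))"
        using l[OF t] assms by (intro frechet_derivative_works[THEN iffD1] smooth_onD(1)) auto
      then show "(f \<circ> ?l has_derivative
          frechet_derivative f (at (?l t)) \<circ> (\<lambda>h. h *\<^sub>R (w - p))) (at t within {0..1})"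
        by (intro diff_chain_within)
           (auto intro!: derivative_eq_intros intro: has_derivative_at_withinI)
    qed simp
    then obtain t where t: "0 < t" "t < 1"
      and eq: "f w - f p = frechet_derivative f (at (?l t)) (w - p)" by auto
    have "?l t \<in> U" using l[of t] t assms(1) by auto
    then have "f w - f p = partial_gradient f (?l t) \<bullet> (w - p)"
      using eq frechet_derivative_eq_partial_gradient smooth_onD(1)[OF assms(2)] by metis
    then have "\<bar>f w - f p - partial_gradient f p \<bullet> (w - p)\<bar>
        = \<bar>(partial_gradient f (?l t) - partial_gradient f p) \<bullet> (w - p)\<bar>"
      by (simp add: inner_diff_left)
    also have "\<dots> \<le> norm (partial_gradient f (?l t) - partial_gradient f p) * norm (w - p)"
      by (rule Cauchy_Schwarz_ineq2)
    also have "\<dots> \<le> (C * norm (?l t - p)) * norm (w - p)"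
      using t l pw by (intro mult_right_mono C) auto
    also have "\<dots> \<le> (C * norm (w - p)) * norm (w - p)"
      using t C(1) by (intro mult_right_mono mult_left_mono) (auto simp: mult_left_le_one_le)
    finally show ?thesis by (simp add: power2_eq_square mult.assoc)
  qed
  then show ?thesis using C(1) by blast
qed

text \<open>Expanding the square turns membership in a ball through the origin with centre
  \<open>s *\<^sub>R u\<close> into a quadratic inequality. Since \<open>s\<close> carries a sign,
  one statement serves the tangent balls on both sides of a hyperplane.\<close>

lemma norm_diff_scaleR_less_iff:
  fixes v u :: "'a::real_inner"
  assumes "norm u = 1"
  shows "norm (v - s *\<^sub>R u) < \<bar>s\<bar> \<longleftrightarrow> (norm v)\<^sup>2 < 2 * s * (u \<bullet> v)"
proof -
  have "norm (v - s *\<^sub>R u) < \<bar>s\<bar> \<longleftrightarrow> (norm (v - s *\<^sub>R u))\<^sup>2 < s\<^sup>2"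
    by (metis abs_norm_cancel abs_square_less_1 power2_abs power2_less_imp_less power_strict_mono abs_ge_zero norm_ge_zero zero_less_numeral)
  also have "(norm (v - s *\<^sub>R u))\<^sup>2 = (norm v)\<^sup>2 - 2 * s * (u \<bullet> v) + s\<^sup>2"
    using assms by (simp add: power2_norm_eq_inner inner_diff_left inner_diff_right inner_commute
        norm_eq_1) (simp add: power2_eq_square)
  finally show ?thesis by auto
qed

text \<open>Near a boundary point, both balls tangent to the boundary at that point avoid the boundary,
  so each lies inside \<open>\<Omega>\<close> or in its complement; by convexity they cannot both be outside.\<close>

lemma local_interior_ball:
  fixes \<Omega> :: "'a::euclidean_space set"
  assumes "convex_body \<Omega>" "local_defining_function (frontier \<Omega>) p0 U \<rho>" "p0 \<in> frontier \<Omega>"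
  shows "\<exists>\<delta>>0. \<exists>s>0. \<forall>p\<in>frontier \<Omega> \<inter> ball p0 \<delta>. \<exists>q. dist q p = s \<and> ball q s \<subseteq> \<Omega>"
proof -
  have U: "open U" "p0 \<in> U" "smooth_on U \<rho>" "frontier \<Omega> \<inter> U = {x \<in> U. \<rho> x = 0}"
    and nz: "\<And>x. x \<in> frontier \<Omega> \<Longrightarrow> x \<in> U \<Longrightarrow> \<exists>v. frechet_derivative \<rho> (at x) v \<noteq> 0"
    using assms(2) by (auto simp: local_defining_function_def)
  have \<Omega>: "convex \<Omega>" "closed \<Omega>" "interior \<Omega> \<noteq> {}"
    using assms(1) by (auto simp: convex_body_def compact_imp_closed)
  let ?n = "partial_gradient \<rho>"
  obtain \<delta>0 where \<delta>0: "\<delta>0 > 0" "cball p0 \<delta>0 \<subseteq> U" using U open_contains_cball by blast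
  obtain L where L: "L \<ge> 0" "\<And>x y. x\<in>cball p0 \<delta>0 \<Longrightarrow> y\<in>cball p0 \<delta>0 \<Longrightarrow>
      norm (?n x - ?n y) \<le> L * norm (x - y)"
    using partial_gradient_lipschitz_on_cball[OF \<delta>0(2) U(3)] by blast
  obtain C where C: "C \<ge> 0" "\<And>p w. p\<in>cball p0 \<delta>0 \<Longrightarrow> w\<in>cball p0 \<delta>0 \<Longrightarrow>
      \<bar>\<rho> w - \<rho> p - ?n p \<bullet> (w - p)\<bar> \<le> C * (norm (w - p))\<^sup>2"
    using smooth_on_taylor_cball[OF \<delta>0(2) U(3)] by blast
  define \<kappa> where "\<kappa> = norm (?n p0) / 2"
  have "?n p0 \<noteq> 0"
    using nz[OF assms(3) U(2)] frechet_derivative_eq_partial_gradient[OF smooth_onD(1)[OF U(3,2)]]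
    by auto
  then have \<kappa>: "\<kappa> > 0" by (simp add: \<kappa>_def)
  \<comment> \<open>The bounds by \<open>\<delta>0\<close> keep \<open>p\<close> and both tangent
    balls at \<open>p\<close> inside \<open>cball p0 \<delta>0\<close>. The bound
    \<open>\<kappa> / (L + 1)\<close> keeps the gradient at \<open>p\<close> at least
    \<open>\<kappa>\<close>, half of its size at \<open>p0\<close>. The bound
    \<open>\<kappa> / (4 * (C + 1))\<close> gives \<open>2 * s * C < \<kappa>\<close>, so that the
    linear term of the Taylor expansion wins in the tangent balls.\<close>
  define \<delta> where "\<delta> = min (\<delta>0 / 2) (\<kappa> / (L + 1))"
  define s where "s = min (\<delta>0 / 4) (\<kappa> / (4 * (C + 1)))"
  have "\<delta> \<le> \<delta>0 / 2" unfolding \<delta>_def by (rule min.cobounded1)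
  then have \<delta>: "\<delta> > 0" "\<delta> \<le> \<delta>0 / 2" and \<delta>L: "L * \<delta> \<le> \<kappa>"
  proof -
    have "L * \<delta> \<le> (L + 1) * (\<kappa> / (L + 1))"
      using L \<kappa> \<delta>0 by (intro mult_mono) (auto simp: \<delta>_def)
    then show "L * \<delta> \<le> \<kappa>" using L by simp
  qed (use \<delta>0 L \<kappa> in \<open>auto simp: \<delta>_def min.coboundedI1\<close>)
  have "s \<le> \<delta>0 / 4" unfolding s_def by (rule min.cobounded1)
  then have s: "s > 0" "s \<le> \<delta>0 / 4" and sC: "2 * s * C < \<kappa>"
  proof -
    have "2 * s * C \<le> 2 * (\<kappa> / (4 * (C + 1))) * (C + 1)"
      using C \<kappa> \<delta>0 by (intro mult_mono) (auto simp: s_def)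
    also have "\<dots> = \<kappa> / 2" using C by (simp add: field_simps)
    finally show "2 * s * C < \<kappa>" using \<kappa> by simp
  qed (use \<delta>0 C \<kappa> in \<open>auto simp: s_def\<close>)
  have "\<exists>q. dist q p = s \<and> ball q s \<subseteq> \<Omega>" if p: "p \<in> frontier \<Omega>" "p \<in> ball p0 \<delta>" for p
  proof (rule ccontr)
    assume no: "\<nexists>q. dist q p = s \<and> ball q s \<subseteq> \<Omega>"
    have pc: "p \<in> cball p0 \<delta>0" using p(2) \<delta> \<delta>0 by auto
    have p\<Omega>: "p \<in> \<Omega>" using p(1) \<Omega>(2) frontier_subset_closed by blast
    have "norm (?n p0 - ?n p) \<le> L * norm (p0 - p)"
      using \<delta>0 pc by (intro L) auto
    also have "\<dots> \<le> L * \<delta>" using p(2) L(1) by (intro mult_left_mono) (auto simp: dist_norm)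
    finally have np: "norm (?n p) \<ge> \<kappa>"
      using norm_triangle_ineq2[of "?n p0" "?n p"] \<delta>L by (simp add: \<kappa>_def)
    define u where "u = ?n p /\<^sub>R norm (?n p)"
    have "?n p \<noteq> 0" using np \<kappa> by auto
    then have u: "norm u = 1" by (simp add: u_def)
    have nu: "?n p \<bullet> v = norm (?n p) * (u \<bullet> v)" for v
    proof -
      have "norm (?n p) * (u \<bullet> v) = (norm (?n p) * inverse (norm (?n p))) * (?n p \<bullet> v)"
        by (simp only: u_def inner_scaleR_left mult.assoc)
      then show ?thesis using \<open>?n p \<noteq> 0\<close> by simp
    qed
    \<comment> \<open>The sign of \<open>\<sigma>\<close> selects one of the two tangent balls. A
      frontier point \<open>w\<close> in it would satisfy
      \<open>norm (w - p) ^ 2 < 2 * s * \<bar>u \<bullet> (w - p)\<bar>\<close>. As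
      \<open>\<rho>\<close> vanishes at \<open>w\<close> and \<open>p\<close>, the Taylor bound
      would then give \<open>norm (?n p) \<le> 2 * s * C\<close>. A connected set that misses the
      frontier and is not inside \<open>\<Omega>\<close> is disjoint from it.\<close>
    have out: "ball (p + \<sigma> *\<^sub>R u) s \<inter> \<Omega> = {}" if \<sigma>: "\<bar>\<sigma>\<bar> = s" for \<sigma>
    proof -
      let ?B = "ball (p + \<sigma> *\<^sub>R u) s"
      have "dist (p + \<sigma> *\<^sub>R u) p = s" using \<sigma> u by (simp add: dist_norm)
      then have "\<not> ?B \<subseteq> \<Omega>" using no by blast
      moreover have "?B \<inter> frontier \<Omega> = {}"
      proof (rule ccontr)
        assume "?B \<inter> frontier \<Omega> \<noteq> {}"
        then obtain w where w: "w \<in> ?B" "w \<in> frontier \<Omega>" by blast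
        have "norm ((w - p) - \<sigma> *\<^sub>R u) < \<bar>\<sigma>\<bar>"
          using w(1) \<sigma> by (simp add: dist_norm norm_minus_commute algebra_simps)
        then have wp: "(norm (w - p))\<^sup>2 < 2 * \<sigma> * (u \<bullet> (w - p))"
          using norm_diff_scaleR_less_iff[OF u] by blast
        have "dist w p \<le> dist w (p + \<sigma> *\<^sub>R u) + dist (p + \<sigma> *\<^sub>R u) p"
          by (rule dist_triangle)
        also have "\<dots> \<le> s + s" using w(1) \<sigma> u by (intro add_mono) (auto simp: dist_commute dist_norm)
        finally have "dist p0 w \<le> \<delta>0"
          using dist_triangle[of p0 w p] p(2) \<delta>(2) s(2) by (simp add: dist_commute)
        then have wc: "w \<in> cball p0 \<delta>0" by simp
        have "\<rho> w = 0" "\<rho> p = 0" using U(4) p(1) w(2) wc pc \<delta>0(2) by blast+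
        then have "norm (?n p) * \<bar>u \<bullet> (w - p)\<bar> \<le> C * (norm (w - p))\<^sup>2"
          using C(2)[OF pc wc] nu[of "w - p"] by (simp add: abs_mult)
        also have "\<dots> \<le> C * (2 * s * \<bar>u \<bullet> (w - p)\<bar>)"
        proof (intro mult_left_mono C)
          have "2 * \<sigma> * (u \<bullet> (w - p)) \<le> \<bar>2 * \<sigma> * (u \<bullet> (w - p))\<bar>" by simp
          then show "(norm (w - p))\<^sup>2 \<le> 2 * s * \<bar>u \<bullet> (w - p)\<bar>" using wp \<sigma> by (simp add: abs_mult)
        qed
        finally have "(norm (?n p) - 2 * s * C) * \<bar>u \<bullet> (w - p)\<bar> \<le> 0" by (simp add: algebra_simps)
        moreover have "norm (?n p) - 2 * s * C > 0" using np sC by linarith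
        moreover have "\<bar>u \<bullet> (w - p)\<bar> > 0"
          using wp zero_le_power2[of "norm (w - p)"] by (cases "u \<bullet> (w - p) = 0") auto
        ultimately show False by (meson mult_pos_pos not_le)
      qed
      ultimately show ?thesis
        using connected_Int_frontier[of ?B \<Omega>] connected_ball by blast
    qed
    obtain x0 e where x0: "e > 0" "cball x0 e \<subseteq> \<Omega>"
      using \<Omega>(3) by (meson all_not_in_conv mem_interior_cball)
    \<comment> \<open>Nonempty interior supplies a point of \<open>\<Omega>\<close> off the tangent
      plane at \<open>p\<close>. The segment from \<open>p\<close> to \<open>x\<close> stays in
      \<open>\<Omega>\<close> and must start inside one of the two tangent balls, against
      \<open>out\<close>.\<close>
    obtain x where x: "x \<in> \<Omega>" "u \<bullet> (x - p) \<noteq> 0"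
    proof (cases "u \<bullet> (x0 - p) = 0")
      case True
      show ?thesis
      proof (rule that)
        show "x0 + e *\<^sub>R u \<in> \<Omega>" using x0 u by (auto simp: dist_norm)
        have "u \<bullet> (x0 + e *\<^sub>R u - p) = u \<bullet> (x0 - p) + e * (u \<bullet> u)"
          by (simp add: inner_simps)
        also have "\<dots> = e" using True u by (simp add: norm_eq_1)
        finally show "u \<bullet> (x0 + e *\<^sub>R u - p) \<noteq> 0" using x0(1) by simp
      qed
    next
      case False
      then show ?thesis using x0 by (intro that[of x0]) auto
    qed
    define v where "v = x - p"
    have v: "u \<bullet> v \<noteq> 0" "v \<noteq> 0" using x by (auto simp: v_def)
    \<comment> \<open>So short a step along \<open>v\<close> that the quadratic term
      \<open>t * norm v ^ 2\<close> stays below the linear term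
      \<open>2 * s * \<bar>u \<bullet> v\<bar>\<close>. The sign in \<open>\<sigma>\<close> below
      picks the ball on the side of \<open>x\<close>.\<close>
    define t where "t = min 1 (s * \<bar>u \<bullet> v\<bar> / (norm v)\<^sup>2)"
    have t: "t > 0" "t \<le> 1" using v s by (auto simp: t_def)
    have "t * (norm v)\<^sup>2 \<le> s * \<bar>u \<bullet> v\<bar>"
    proof -
      have "t * (norm v)\<^sup>2 \<le> (s * \<bar>u \<bullet> v\<bar> / (norm v)\<^sup>2) * (norm v)\<^sup>2"
        by (intro mult_right_mono) (auto simp: t_def)
      then show ?thesis using v by simp
    qed
    also have "\<dots> < 2 * s * \<bar>u \<bullet> v\<bar>" using v s by simp
    finally have tv: "t * (norm v)\<^sup>2 < 2 * s * \<bar>u \<bullet> v\<bar>" .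
    define \<sigma> where "\<sigma> = s * sgn (u \<bullet> v)"
    have \<sigma>: "\<bar>\<sigma>\<bar> = s" using v s by (simp add: \<sigma>_def abs_mult abs_sgn_eq)
    have "t * (t * (norm v)\<^sup>2) < t * (2 * s * \<bar>u \<bullet> v\<bar>)"
      using tv t by (intro mult_strict_left_mono)
    also have "s * \<bar>u \<bullet> v\<bar> = \<sigma> * (u \<bullet> v)" by (simp add: \<sigma>_def abs_sgn mult_ac)
    then have "t * (2 * s * \<bar>u \<bullet> v\<bar>) = 2 * \<sigma> * (u \<bullet> (t *\<^sub>R v))" by (simp add: mult_ac)
    finally have "(norm (t *\<^sub>R v))\<^sup>2 < 2 * \<sigma> * (u \<bullet> (t *\<^sub>R v))"
      using t by (simp add: power_mult_distrib power2_eq_square mult_ac)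
    then have "norm (t *\<^sub>R v - \<sigma> *\<^sub>R u) < s"
      using norm_diff_scaleR_less_iff[OF u] \<sigma> by metis
    then have "p + t *\<^sub>R v \<in> ball (p + \<sigma> *\<^sub>R u) s"
      by (simp add: dist_norm norm_minus_commute algebra_simps)
    moreover have "p + t *\<^sub>R v \<in> \<Omega>"
      using convexD_alt[OF \<Omega>(1) p\<Omega> x(1), of t] t by (simp add: v_def algebra_simps)
    ultimately show False using out[OF \<sigma>] by (meson disjoint_iff)
  qed
  then show ?thesis using \<delta>(1) s(1) by blast
qed

text \<open>The homothety with centre \<open>p\<close> and ratio \<open>s' / s\<close> produces an
  internally tangent ball. It allows touching radii to be lowered to a common value.\<close>

lemma shrink_touching_ball:
  fixes q p :: "'a::real_normed_vector"
  assumes "dist q p = s" "0 < s'" "s' \<le> s"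
  shows "\<exists>q'. dist q' p = s' \<and> ball q' s' \<subseteq> ball q s"
proof (intro exI conjI)
  let ?q = "p + (s' / s) *\<^sub>R (q - p)"
  show "dist ?q p = s'" using assms by (simp add: dist_norm)
  have "?q - q = (1 - s' / s) *\<^sub>R (p - q)" by (simp add: algebra_simps)
  then have "dist ?q q = \<bar>1 - s' / s\<bar> * s"
    using assms(1) by (simp add: dist_norm norm_minus_commute)
  also have "\<dots> = s - s'" using assms by (simp add: field_simps)
  finally have "dist ?q q = s - s'" .
  then show "ball ?q s' \<subseteq> ball q s"
  proof (intro subsetI)
    fix x assume "x \<in> ball ?q s'"
    then show "x \<in> ball q s"
      using dist_triangle[of q x ?q] \<open>dist ?q q = s - s'\<close> by (simp add: dist_commute)
  qed
qed

lemma uniform_interior_ball: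
  fixes \<Omega> :: "'a::euclidean_space set"
  assumes "convex_body \<Omega>" "smooth_hypersurface (frontier \<Omega>)"
  shows "\<exists>s>0. \<forall>p\<in>frontier \<Omega>. \<exists>q. dist q p = s \<and> ball q s \<subseteq> \<Omega>"
proof -
  have "\<forall>p0\<in>frontier \<Omega>. \<exists>\<delta>>0. \<exists>s>0. \<forall>p\<in>frontier \<Omega> \<inter> ball p0 \<delta>.
      \<exists>q. dist q p = s \<and> ball q s \<subseteq> \<Omega>"
    using assms local_interior_ball unfolding smooth_hypersurface_def by blast
  then obtain \<delta> s where \<delta>s: "\<And>p0. p0 \<in> frontier \<Omega> \<Longrightarrow> \<delta> p0 > 0 \<and> s p0 > (0::real)"
    "\<And>p0 p. p0 \<in> frontier \<Omega> \<Longrightarrow> p \<in> frontier \<Omega> \<Longrightarrow> p \<in> ball p0 (\<delta> p0) \<Longrightarrow>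
      \<exists>q. dist q p = s p0 \<and> ball q (s p0) \<subseteq> \<Omega>"
    by (metis IntI)
  have "compact (frontier \<Omega>)"
    using assms(1) by (simp add: convex_body_def compact_frontier)
  moreover have "frontier \<Omega> \<subseteq> (\<Union>p\<in>frontier \<Omega>. ball p (\<delta> p))" using \<delta>s(1) by force
  ultimately obtain P where P: "P \<subseteq> frontier \<Omega>" "finite P" "frontier \<Omega> \<subseteq> (\<Union>p\<in>P. ball p (\<delta> p))"
    using compactE_image[of "frontier \<Omega>" "frontier \<Omega>" "\<lambda>p. ball p (\<delta> p)"] by auto
  \<comment> \<open>The inserted 1 keeps the argument of \<open>Min\<close> nonempty whatever
    \<open>P\<close> is.\<close>
  define s0 where "s0 = Min (insert 1 (s ` P))"
  have s0: "s0 > 0" using P \<delta>s(1) by (auto simp: s0_def)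
  have "\<exists>q. dist q p = s0 \<and> ball q s0 \<subseteq> \<Omega>" if p: "p \<in> frontier \<Omega>" for p
  proof -
    obtain p0 where p0: "p0 \<in> P" "p \<in> ball p0 (\<delta> p0)" using P p by blast
    then obtain q where q: "dist q p = s p0" "ball q (s p0) \<subseteq> \<Omega>" using \<delta>s(2) P p by blast
    have "s0 \<le> s p0" using P p0 by (auto simp: s0_def)
    from shrink_touching_ball[OF q(1) s0 this] q(2) show ?thesis by blast
  qed
  then show ?thesis using s0 by blast
qed

section \<open>Volume of caps\<close>

text \<open>A ball of radius \<open>r\<close> comparable to \<open>sqrt (s * h)\<close> is covered by about \<open>r / h\<close> translates
  of a slab of thickness \<open>h / 2\<close> and radius \<open>r\<close>, and such a slab fits into the cap.\<close>

lemma ball_cap_measure: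
  fixes p \<theta> :: "'a::euclidean_space"
  assumes "compact \<Omega>" "ball (p + s *\<^sub>R \<theta>) s \<subseteq> \<Omega>" "norm \<theta> = 1" "0 < h" "h \<le> s"
  shows "(measure lebesgue {w\<in>\<Omega>. \<theta> \<bullet> (w - p) \<le> h})\<^sup>2
    \<ge> (unit_ball_vol DIM('a) / 14)\<^sup>2 * (s / 4) ^ (DIM('a) - 1) * h ^ (DIM('a) + 1)"
proof -
  have s: "s > 0" using assms by simp
  \<comment> \<open>With \<open>a = \<theta> \<bullet> y\<close> between \<open>h / 2\<close> and
    \<open>h\<close>, and \<open>h \<le> s\<close>, a point of the slab has squared norm at most
    \<open>s * h / 4 + a ^ 2 < 2 * s * a\<close>, which is the condition for lying in the tangent
    ball. The lower face at height \<open>h / 2\<close> rather than 0 makes this possible.\<close>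
  define r where "r = sqrt (s * h / 4)"
  have r: "r > 0" "r\<^sup>2 = s * h / 4" using assms s by (auto simp: r_def)
  have hr: "h \<le> 2 * r"
  proof (rule power2_le_imp_le)
    show "h\<^sup>2 \<le> (2 * r)\<^sup>2" using assms s by (simp add: power_mult_distrib r) (simp add: power2_eq_square)
  qed (use r in simp)
  define P where "P = {y. h / 2 \<le> \<theta> \<bullet> y \<and> \<theta> \<bullet> y \<le> h \<and> (norm y)\<^sup>2 - (\<theta> \<bullet> y)\<^sup>2 \<le> r\<^sup>2}"
  have "closed P" unfolding P_def
    by (intro closed_Collect_conj closed_Collect_le continuous_intros)
  moreover have "bounded P"
  proof (rule boundedI)
    fix y assume y: "y \<in> P"
    have "(\<theta> \<bullet> y)\<^sup>2 \<le> h\<^sup>2" using y assms by (intro power_mono) (auto simp: P_def)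
    then have "(norm y)\<^sup>2 \<le> r\<^sup>2 + h\<^sup>2" using y unfolding P_def mem_Collect_eq by linarith
    then show "norm y \<le> sqrt (r\<^sup>2 + h\<^sup>2)" by (rule real_le_rsqrt)
  qed
  ultimately have "compact P" by (simp add: compact_eq_bounded_closed)
  then have Pm: "P \<in> lmeasurable" by (rule lmeasurable_compact)
  define \<rho> where "\<rho> = 2 * r / h"
  have \<rho>: "\<rho> \<ge> 1" using hr assms by (simp add: \<rho>_def)
  \<comment> \<open>Shifts by multiples of \<open>h / 2\<close> have to sweep heights from
    \<open>- r\<close> to \<open>r\<close>, that is, \<open>- \<rho>\<close> to
    \<open>\<rho>\<close> in units of \<open>h / 2\<close>. The cardinality is at most
    \<open>2 * \<rho> + 5\<close>, hence at most \<open>7 * \<rho>\<close> because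
    \<open>\<rho> \<ge> 1\<close>.\<close>
  define J :: "int set" where "J = {-\<lceil>\<rho>\<rceil> - 2..\<lceil>\<rho>\<rceil>}"
  have J: "finite J" "real (card J) \<le> 7 * \<rho>"
  proof -
    have "real (card J) = 2 * of_int \<lceil>\<rho>\<rceil> + 3" using \<rho> by (simp add: J_def)
    also have "\<dots> \<le> 2 * (\<rho> + 1) + 3" by (intro add_mono mult_left_mono) auto
    finally show "real (card J) \<le> 7 * \<rho>" using \<rho> by simp
  qed (simp add: J_def)
  have \<theta>\<theta>: "\<theta> \<bullet> \<theta> = 1" using assms(3) by (simp add: norm_eq_1)
  have sub: "ball 0 r \<subseteq> (\<Union>j\<in>J. (+) ((of_int j * h / 2) *\<^sub>R \<theta>) ` P)"
  proof
    fix y :: 'a assume "y \<in> ball 0 r"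
    then have y: "norm y < r" by simp
    define a where "a = \<theta> \<bullet> y"
    have "\<bar>a\<bar> \<le> norm \<theta> * norm y" unfolding a_def by (rule Cauchy_Schwarz_ineq2)
    then have a: "\<bar>a\<bar> \<le> r" using y assms(3) by simp
    \<comment> \<open>Subtracting 1 leaves a remainder between 1 and 2 in units of
      \<open>h / 2\<close>, matching the slab between the heights \<open>h / 2\<close> and
      \<open>h\<close>.\<close>
    define j where "j = \<lfloor>2 * a / h\<rfloor> - 1"
    have j: "2 * a / h - of_int j \<ge> 1" "2 * a / h - of_int j \<le> 2"
      unfolding j_def by linarith+
    have "\<bar>2 * a / h\<bar> \<le> \<rho>"
      using a assms by (simp add: \<rho>_def abs_mult divide_right_mono)
    then have "j \<ge> -\<lceil>\<rho>\<rceil> - 2" "j \<le> \<lceil>\<rho>\<rceil>" unfolding j_def by linarith+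
    then have jJ: "j \<in> J" by (simp add: J_def)
    define y' where "y' = y - (of_int j * h / 2) *\<^sub>R \<theta>"
    have ty: "\<theta> \<bullet> y' = a - of_int j * h / 2"
      by (simp add: y'_def inner_diff_right a_def \<theta>\<theta>)
    define c where "c = of_int j * h / 2"
    have y': "y' = y - c *\<^sub>R \<theta>" by (simp add: y'_def c_def)
    have "(norm y')\<^sup>2 = (norm y)\<^sup>2 - 2 * c * a + c\<^sup>2"
      unfolding y' power2_norm_eq_inner inner_diff_left inner_diff_right inner_scaleR_left
        inner_scaleR_right \<theta>\<theta> inner_commute[of y \<theta>] a_def[symmetric]
      by (simp add: power2_eq_square algebra_simps)
    moreover have "(\<theta> \<bullet> y')\<^sup>2 = a\<^sup>2 - 2 * c * a + c\<^sup>2"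
      unfolding ty c_def[symmetric] by (simp add: power2_diff mult_ac)
    ultimately have "(norm y')\<^sup>2 - (\<theta> \<bullet> y')\<^sup>2 = (norm y)\<^sup>2 - a\<^sup>2" by simp
    also have "\<dots> \<le> (norm y)\<^sup>2" by simp
    also have "\<dots> \<le> r\<^sup>2" using y by (intro power_mono) auto
    finally have "y' \<in> P" using j assms by (simp add: P_def ty field_simps)
    then show "y \<in> (\<Union>j\<in>J. (+) ((of_int j * h / 2) *\<^sub>R \<theta>) ` P)"
      using jJ by (intro UN_I[of j] image_eqI[of _ _ y']) (auto simp: y'_def)
  qed
  have fm: "(+) x ` P \<in> lmeasurable" for x using Pm by (rule measurable_translation)
  have "unit_ball_vol DIM('a) * r ^ DIM('a) = measure lebesgue (ball (0::'a) r)"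
    using r by (simp add: content_ball)
  also have "\<dots> \<le> measure lebesgue (\<Union>j\<in>J. (+) ((of_int j * h / 2) *\<^sub>R \<theta>) ` P)"
    using fm J by (intro measure_mono_fmeasurable sub) (auto intro!: fmeasurable.finite_UN)
  also have "\<dots> \<le> (\<Sum>j\<in>J. measure lebesgue ((+) ((of_int j * h / 2) *\<^sub>R \<theta>) ` P))"
    using fm J by (intro measure_UNION_le) auto
  also have "\<dots> = card J * measure lebesgue P" by (simp add: measure_translation)
  also have "\<dots> \<le> 7 * \<rho> * measure lebesgue P" using J by (intro mult_right_mono) auto
  also have "measure lebesgue P = measure lebesgue ((+) p ` P)" by (simp add: measure_translation)
  also have "\<dots> \<le> measure lebesgue {w\<in>\<Omega>. \<theta> \<bullet> (w - p) \<le> h}"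
  proof (rule measure_mono_fmeasurable)
    show "(+) p ` P \<subseteq> {w\<in>\<Omega>. \<theta> \<bullet> (w - p) \<le> h}"
    proof safe
      fix y assume y: "y \<in> P"
      let ?a = "\<theta> \<bullet> y"
      have a: "h / 2 \<le> ?a" "?a \<le> h" using y by (auto simp: P_def)
      have "(norm y)\<^sup>2 \<le> s * h / 4 + ?a\<^sup>2" using y by (auto simp: P_def r)
      also have "?a\<^sup>2 \<le> s * ?a" using a assms by (simp add: power2_eq_square)
      also have "s * h / 4 + s * ?a < s * ?a + s * ?a"
        using a s assms(4) mult_left_mono[OF a(1), of s] by simp
      finally have "(norm y)\<^sup>2 < 2 * s * ?a" by simp
      then have "norm (y - s *\<^sub>R \<theta>) < \<bar>s\<bar>" using norm_diff_scaleR_less_iff[OF assms(3)] by blast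
      then have "p + y \<in> ball (p + s *\<^sub>R \<theta>) s"
        using s by (simp add: dist_norm norm_minus_commute)
      then show "p + y \<in> \<Omega>" using assms(2) by blast
      show "\<theta> \<bullet> (p + y - p) \<le> h" using a by simp
    qed
    have "{w\<in>\<Omega>. \<theta> \<bullet> (w - p) \<le> h} = \<Omega> \<inter> {w. \<theta> \<bullet> (w - p) \<le> h}" by blast
    moreover have "closed {w. \<theta> \<bullet> (w - p) \<le> h}"
      by (intro closed_Collect_le continuous_intros)
    ultimately show "{w\<in>\<Omega>. \<theta> \<bullet> (w - p) \<le> h} \<in> lmeasurable"
      using assms(1) by (auto intro!: lmeasurable_compact compact_Int_closed)
  qed (use fm in auto)
  finally have "unit_ball_vol DIM('a) * r ^ DIM('a)
      \<le> 7 * \<rho> * measure lebesgue {w\<in>\<Omega>. \<theta> \<bullet> (w - p) \<le> h}"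
    using \<rho> by simp
  moreover have "r ^ DIM('a) = r * r ^ (DIM('a) - 1)"
    by (metis DIM_positive Suc_diff_1 power_Suc)
  ultimately have "r * (unit_ball_vol DIM('a) * r ^ (DIM('a) - 1) * h)
      \<le> r * (14 * measure lebesgue {w\<in>\<Omega>. \<theta> \<bullet> (w - p) \<le> h})"
    using assms(4) by (simp add: \<rho>_def field_simps)
  then have "unit_ball_vol DIM('a) / 14 * (r ^ (DIM('a) - 1) * h)
      \<le> measure lebesgue {w\<in>\<Omega>. \<theta> \<bullet> (w - p) \<le> h}"
    using r by simp
  \<comment> \<open>Squaring removes the half-integral exponents coming from
    \<open>r = sqrt (s * h / 4)\<close>. The 14 is the 7 of the covering times the 2 in
    \<open>\<rho> = 2 * r / h\<close>.\<close>
  then have "(unit_ball_vol DIM('a) / 14 * (r ^ (DIM('a) - 1) * h))\<^sup>2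
      \<le> (measure lebesgue {w\<in>\<Omega>. \<theta> \<bullet> (w - p) \<le> h})\<^sup>2"
    using r assms(4) by (intro power_mono) auto
  also have "(unit_ball_vol DIM('a) / 14 * (r ^ (DIM('a) - 1) * h))\<^sup>2
      = (unit_ball_vol DIM('a) / 14)\<^sup>2 * ((r\<^sup>2) ^ (DIM('a) - 1) * h\<^sup>2)"
    by (simp only: power_mult_distrib power_mult[symmetric] mult.commute[of 2])
  also have "r\<^sup>2 = s / 4 * h" using r(2) by simp
  also have "(s / 4 * h) ^ (DIM('a) - 1) * h\<^sup>2 = (s / 4) ^ (DIM('a) - 1) * h ^ (DIM('a) + 1)"
  proof -
    have "DIM('a) + 1 = (DIM('a) - 1) + 2" by (simp add: Suc_leI)
    then show ?thesis by (simp only: power_mult_distrib power_add mult.assoc)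
  qed
  finally show ?thesis by (simp add: mult.assoc)
qed

text \<open>Moving from \<open>q\<close> against \<open>m\<close> by any distance below
  \<open>s\<close> stays in \<open>\<Omega>\<close>, so minimality of \<open>p\<close> forces
  \<open>m \<bullet> (q - p) \<ge> s * norm m\<close>. As \<open>norm (q - p) = s\<close>, this is
  the equality case of Cauchy-Schwarz.\<close>

lemma minimizing_point_of_touching_ball:
  fixes p q m :: "'a::euclidean_space"
  assumes "ball q s \<subseteq> \<Omega>" "dist q p = s" "\<And>w. w \<in> \<Omega> \<Longrightarrow> m \<bullet> p \<le> m \<bullet> w" "m \<noteq> 0" "s > 0"
  shows "q = p + s *\<^sub>R (m /\<^sub>R norm m)"
proof -
  have "norm m * t \<le> m \<bullet> (q - p)" if t: "0 < t" "t < s" for t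
  proof -
    have "q - t *\<^sub>R (m /\<^sub>R norm m) \<in> ball q s"
    proof -
      have "norm (m /\<^sub>R norm m) = 1" using assms(4) by simp
      then have "norm (t *\<^sub>R (m /\<^sub>R norm m)) = t" using t by (simp only: norm_scaleR)
      moreover have "dist q (q - t *\<^sub>R (m /\<^sub>R norm m)) = norm (t *\<^sub>R (m /\<^sub>R norm m))"
        by (simp only: dist_norm diff_diff_eq2 add_diff_cancel_left')
      ultimately have "dist q (q - t *\<^sub>R (m /\<^sub>R norm m)) = t" by (simp only:)
      then show ?thesis using t by (simp only: mem_ball)
    qed
    then have "m \<bullet> p \<le> m \<bullet> (q - t *\<^sub>R (m /\<^sub>R norm m))" using assms by blast
    also have "\<dots> = m \<bullet> q - t * norm m"
      using assms(4) by (simp add: inner_diff_right dot_square_norm power2_eq_square)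
    finally show ?thesis by (simp add: inner_diff_right mult.commute)
  qed
  then have A: "t \<le> m \<bullet> (q - p) / norm m" if "0 < t" "t < s" for t
    using that assms by (simp add: field_simps)
  have "s \<le> m \<bullet> (q - p) / norm m" by (rule dense_le_bounded[OF assms(5) A])
  then have "norm m * norm (q - p) \<le> m \<bullet> (q - p)"
    using assms by (simp add: field_simps dist_norm)
  then have "m \<bullet> (q - p) = norm m * norm (q - p)"
    using norm_cauchy_schwarz[of m "q - p"] by linarith
  then have "norm m *\<^sub>R (q - p) = s *\<^sub>R m"
    using assms(2) by (simp add: norm_cauchy_schwarz_eq dist_norm)
  then have "(1 / norm m) *\<^sub>R (norm m *\<^sub>R (q - p)) = (1 / norm m) *\<^sub>R (s *\<^sub>R m)" by simp
  then have "q - p = s *\<^sub>R (m /\<^sub>R norm m)"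
    using assms by (simp add: divide_inverse mult.commute)
  then show ?thesis by (simp add: algebra_simps)
qed

text \<open>The minimiser of a nonzero linear functional lies on the frontier, and the interior ball
  touching there has its centre in the direction of \<open>m\<close>. The ball therefore provides
  the cap, with constants independent of \<open>m\<close>.\<close>

lemma cap_measure_lower_bound:
  fixes \<Omega> :: "'a::euclidean_space set"
  assumes "convex_body \<Omega>" "smooth_hypersurface (frontier \<Omega>)"
  shows "\<exists>s>0. \<exists>c>0. \<forall>m. m \<noteq> 0 \<longrightarrow> (\<exists>p\<in>\<Omega>. (\<forall>w\<in>\<Omega>. m \<bullet> p \<le> m \<bullet> w) \<and>
    (\<forall>h. 0 < h \<and> h \<le> s \<longrightarrow>
      (measure lebesgue {w\<in>\<Omega>. m \<bullet> (w - p) \<le> norm m * h})\<^sup>2 \<ge> c * h ^ (DIM('a) + 1)))"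
proof -
  have comp: "compact \<Omega>" "\<Omega> \<noteq> {}"
    using assms(1) interior_subset by (auto simp: convex_body_def)
  obtain s where s: "s > 0" "\<And>p. p \<in> frontier \<Omega> \<Longrightarrow> \<exists>q. dist q p = s \<and> ball q s \<subseteq> \<Omega>"
    using uniform_interior_ball[OF assms] by blast
  define c where "c = (unit_ball_vol DIM('a) / 14)\<^sup>2 * (s / 4) ^ (DIM('a) - 1)"
  have "unit_ball_vol (real DIM('a)) > 0" by simp
  then have c: "c > 0" using s unfolding c_def by (intro mult_pos_pos zero_less_power divide_pos_pos) auto
  have "\<exists>p\<in>\<Omega>. (\<forall>w\<in>\<Omega>. m \<bullet> p \<le> m \<bullet> w) \<and> (\<forall>h. 0 < h \<and> h \<le> s \<longrightarrow>
      (measure lebesgue {w\<in>\<Omega>. m \<bullet> (w - p) \<le> norm m * h})\<^sup>2 \<ge> c * h ^ (DIM('a) + 1))"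
    if m: "m \<noteq> 0" for m
  proof -
    obtain p where p: "p \<in> \<Omega>" "\<And>w. w \<in> \<Omega> \<Longrightarrow> m \<bullet> p \<le> m \<bullet> w"
      using continuous_attains_inf[OF comp continuous_on_inner[OF continuous_on_const continuous_on_id]]
      by blast
    have "p \<notin> interior \<Omega>"
    proof
      assume "p \<in> interior \<Omega>"
      then obtain e where e: "e > 0" "cball p e \<subseteq> \<Omega>" by (meson mem_interior_cball)
      have "p - e *\<^sub>R (m /\<^sub>R norm m) \<in> cball p e"
      proof -
        have "norm (m /\<^sub>R norm m) = 1" using m by simp
        then have "norm (e *\<^sub>R (m /\<^sub>R norm m)) = e" using e by (simp only: norm_scaleR)
        moreover have "dist p (p - e *\<^sub>R (m /\<^sub>R norm m)) = norm (e *\<^sub>R (m /\<^sub>R norm m))"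
          by (simp only: dist_norm diff_diff_eq2 add_diff_cancel_left')
        ultimately have "dist p (p - e *\<^sub>R (m /\<^sub>R norm m)) = e" by (simp only:)
        then show ?thesis by (simp only: mem_cball order_refl)
      qed
      then have "m \<bullet> p \<le> m \<bullet> (p - e *\<^sub>R (m /\<^sub>R norm m))" using e p by blast
      also have "\<dots> = m \<bullet> p - e * norm m"
        using m by (simp add: inner_diff_right dot_square_norm power2_eq_square)
      finally show False using m e by (simp add: mult_le_0_iff)
    qed
    then have "p \<in> frontier \<Omega>" using p(1) closure_subset by (auto simp: frontier_def)
    then obtain q where q: "dist q p = s" "ball q s \<subseteq> \<Omega>" using s by blast
    have qe: "q = p + s *\<^sub>R (m /\<^sub>R norm m)"
      by (rule minimizing_point_of_touching_ball[OF q(2,1) p(2) m s(1)])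
    have "(measure lebesgue {w\<in>\<Omega>. m \<bullet> (w - p) \<le> norm m * h})\<^sup>2 \<ge> c * h ^ (DIM('a) + 1)"
      if h: "0 < h" "h \<le> s" for h
    proof -
      have eq: "(m /\<^sub>R norm m) \<bullet> (w - p) \<le> h \<longleftrightarrow> m \<bullet> (w - p) \<le> norm m * h" for w
        using m by (simp add: field_simps)
      have "norm (m /\<^sub>R norm m) = 1" using m by simp
      from ball_cap_measure[OF comp(1) q(2)[unfolded qe] this h] show ?thesis
        unfolding eq c_def .
    qed
    then show ?thesis using p by blast
  qed
  then show ?thesis using s(1) c by blast
qed

section \<open>Integrals over the unit cell\<close>

text \<open>Half-open, so that its lattice translates partition the space exactly. The closed cube
  over which the torus is integrated differs from it by a null set.\<close>

definition unit_cell :: "(real ^ 'n::finite) set" where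
  "unit_cell = {x. \<forall>i. 0 \<le> x $ i \<and> x $ i < 1}"

lemma unit_cell_borel [measurable]: "unit_cell \<in> sets borel"
proof -
  have "unit_cell = (\<Inter>i. {x::real^'n. 0 \<le> x $ i} \<inter> {x. x $ i < 1})"
    by (auto simp: unit_cell_def)
  also have "\<dots> \<in> sets borel"
    by (intro sets.finite_INT sets.Int borel_closed borel_open closed_Collect_le open_Collect_less
        continuous_intros) auto
  finally show ?thesis .
qed

lemma unit_cell_eq_cbox_AE:
  "AE x in lborel. x \<in> unit_cell \<longleftrightarrow> x \<in> cbox 0 (1 :: real ^ 'n::finite)"
proof -
  have "cbox 0 1 - box 0 1 \<in> null_sets (lborel :: (real ^ 'n) measure)"
    by (auto simp: emeasure_Diff emeasure_lborel_box_eq emeasure_lborel_cbox_eq null_setsI subset_box)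
  then have "AE x in lborel. x \<notin> cbox 0 1 - box 0 (1 :: real ^ 'n)" by (rule AE_not_in)
  then show ?thesis
    by eventually_elim (auto simp: unit_cell_def mem_box_cart less_imp_le)
qed

lemma set_integral_unit_cell:
  fixes f :: "real ^ 'n::finite \<Rightarrow> 'b::{banach, second_countable_topology}"
  assumes [measurable]: "f \<in> borel_measurable borel"
  shows "(LINT x:cbox 0 1|lborel. f x) = (LINT x:unit_cell|lborel. f x)"
  unfolding set_lebesgue_integral_def
proof (rule integral_cong_AE)
  show "AE x in lborel. indicator (cbox 0 1) x *\<^sub>R f x = indicator unit_cell x *\<^sub>R f x"
    using unit_cell_eq_cbox_AE by eventually_elim (auto simp: indicator_def)
qed measurable

section \<open>The integer lattice and its fundamental domain\<close>

lemma integer_lattice_diff: "a \<in> integer_lattice \<Longrightarrow> b \<in> integer_lattice \<Longrightarrow> a - b \<in> integer_lattice"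
  by (simp add: integer_lattice_def)

lemma integer_lattice_uminus: "a \<in> integer_lattice \<Longrightarrow> - a \<in> integer_lattice"
  by (simp add: integer_lattice_def)

lemma inner_integer_lattice:
  "a \<in> integer_lattice \<Longrightarrow> b \<in> integer_lattice \<Longrightarrow> a \<bullet> b \<in> \<int>"
  by (auto simp: integer_lattice_def inner_vec_def)

lemma cis_inner_lattice_shift:
  assumes "m \<in> integer_lattice" "k \<in> integer_lattice"
  shows "cis (2 * pi * (m \<bullet> (x - k))) = cis (2 * pi * (m \<bullet> x))"
proof -
  have "cis (2 * pi * (m \<bullet> (x - k))) = cis (2 * pi * (m \<bullet> x)) / cis (2 * pi * (m \<bullet> k))"
    by (simp add: inner_diff_right right_diff_distrib cis_divide)
  then show ?thesis using cis_multiple_2pi[OF inner_integer_lattice[OF assms]] by simp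
qed

lemma ex1_lattice_translate_unit_cell:
  "\<exists>!k. k \<in> integer_lattice \<and> x + k \<in> unit_cell"
proof (rule ex1I[of _ "\<chi> i. - of_int \<lfloor>x $ i\<rfloor>"])
  show "(\<chi> i. - of_int \<lfloor>x $ i\<rfloor>) \<in> integer_lattice \<and> x + (\<chi> i. - of_int \<lfloor>x $ i\<rfloor>) \<in> unit_cell"
    by (auto simp: integer_lattice_def unit_cell_def) linarith
next
  fix k assume k: "k \<in> integer_lattice \<and> x + k \<in> unit_cell"
  show "k = (\<chi> i. - of_int \<lfloor>x $ i\<rfloor>)"
  proof (rule vec_eq_iff[THEN iffD2, rule_format])
    fix i
    obtain a :: int where a: "k $ i = of_int a"
      using k by (auto simp: integer_lattice_def elim: Ints_cases)
    have "0 \<le> x $ i + of_int a" "x $ i + of_int a < 1"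
      using k by (auto simp: unit_cell_def a[symmetric])
    then have "\<lfloor>x $ i\<rfloor> = - a" by linarith
    then show "k $ i = (\<chi> i. - of_int \<lfloor>x $ i\<rfloor>) $ i" by (simp add: a)
  qed
qed

lemma finite_integer_lattice_norm_le:
  "finite {k \<in> integer_lattice :: (real ^ 'n::finite) set. norm k \<le> B}"
proof (rule finite_subset)
  show "{k \<in> integer_lattice. norm k \<le> B}
      \<subseteq> (\<lambda>g. \<chi> i. of_int (g i)) ` (PiE (UNIV :: 'n set) (\<lambda>_. {-\<lceil>B\<rceil>..\<lceil>B\<rceil>}))"
  proof
    fix k :: "real ^ 'n" assume k: "k \<in> {k \<in> integer_lattice. norm k \<le> B}"
    have "\<exists>a\<in>{-\<lceil>B\<rceil>..\<lceil>B\<rceil>}. k $ i = of_int a" for i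
    proof -
      obtain a :: int where a: "k $ i = of_int a"
        using k by (auto simp: integer_lattice_def elim: Ints_cases)
      have "\<bar>of_int a\<bar> \<le> B" using component_le_norm_cart[of k i] k by (simp add: a)
      then show ?thesis using a by (intro bexI[of _ a]) (auto, linarith+)
    qed
    then obtain g where "\<And>i. g i \<in> {-\<lceil>B\<rceil>..\<lceil>B\<rceil>}" "\<And>i. k $ i = of_int (g i)" by metis
    then show "k \<in> (\<lambda>g. \<chi> i. of_int (g i)) ` (PiE (UNIV :: 'n set) (\<lambda>_. {-\<lceil>B\<rceil>..\<lceil>B\<rceil>}))"
      by (intro image_eqI[of _ _ g]) (auto simp: vec_eq_iff)
  qed
qed (auto intro!: finite_imageI finite_PiE)

lemma norm_le_card_times:
  fixes x :: "real ^ 'n::finite" and B :: real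
  assumes "\<And>i. \<bar>x $ i\<bar> \<le> B"
  shows "norm x \<le> CARD('n) * B"
proof -
  have "norm x \<le> (\<Sum>i\<in>UNIV. \<bar>x $ i\<bar>)" by (rule norm_le_l1_cart)
  also have "\<dots> \<le> (\<Sum>i\<in>(UNIV::'n set). B)" by (intro sum_mono assms)
  finally show ?thesis by simp
qed

section \<open>Translation and unfolding of integrals\<close>

lemma lborel_integral_translate:
  fixes f :: "'a::euclidean_space \<Rightarrow> 'b::{banach, second_countable_topology}"
  assumes [measurable]: "f \<in> borel_measurable borel"
  shows "(\<integral>x. f (c + x) \<partial>lborel) = (\<integral>x. f x \<partial>lborel)"
proof -
  have "(\<integral>x. f x \<partial>lborel) = (\<integral>x. f x \<partial>distr lborel borel ((+) c))"
    by (simp add: lborel_distr_plus)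
  also have "\<dots> = (\<integral>x. f (c + x) \<partial>lborel)" by (rule integral_distr) auto
  finally show ?thesis ..
qed

lemma lborel_integrable_translate:
  fixes f :: "'a::euclidean_space \<Rightarrow> 'b::{banach, second_countable_topology}"
  assumes "integrable lborel f"
  shows "integrable lborel (\<lambda>x. f (c + x))"
proof -
  have "integrable (distr lborel borel ((+) c)) f" using assms by (simp add: lborel_distr_plus)
  then show ?thesis by (rule integrable_distr[rotated]) simp
qed

text \<open>Unfolding: each point has exactly one lattice translate in the cell, so an integral over
  the whole space is the cell integral of the periodisation. The finite set \<open>F\<close>,
  available for functions of bounded support, avoids interchanging an infinite sum with the
  integral.\<close>

lemma integral_eq_unit_cell_sum:
  fixes f :: "real ^ 'n::finite \<Rightarrow> 'b::{banach, second_countable_topology}"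
  assumes f: "integrable lborel f" and F: "finite F" "F \<subseteq> integer_lattice"
    and supp: "\<And>x k. f x \<noteq> 0 \<Longrightarrow> k \<in> integer_lattice \<Longrightarrow> x + k \<in> unit_cell \<Longrightarrow> k \<in> F"
  shows "(\<integral>x. f x \<partial>lborel) = (LINT x:unit_cell|lborel. (\<Sum>k\<in>F. f (x - k)))"
proof -
  have [measurable]: "f \<in> borel_measurable borel" using borel_measurable_integrable[OF f] by simp
  have "f x = (\<Sum>k\<in>F. indicator unit_cell (k + x) *\<^sub>R f x)" for x
  proof (cases "f x = 0")
    case False
    obtain k0 where k0: "k0 \<in> integer_lattice" "x + k0 \<in> unit_cell"
      and uniq: "\<And>k. k \<in> integer_lattice \<Longrightarrow> x + k \<in> unit_cell \<Longrightarrow> k = k0"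
      using ex1_lattice_translate_unit_cell[of x] by blast
    have k0F: "k0 \<in> F" using supp False k0 by blast
    have "(\<Sum>k\<in>F. indicator unit_cell (k + x) *\<^sub>R f x)
        = (\<Sum>k\<in>{k0}. indicator unit_cell (k + x) *\<^sub>R f x)"
      using F k0F uniq by (intro sum.mono_neutral_right) (auto simp: add.commute indicator_def)
    also have "\<dots> = f x" using k0 by (simp add: indicator_def add.commute[of k0])
    finally show ?thesis ..
  qed simp
  then have "(\<integral>x. f x \<partial>lborel) = (\<integral>x. (\<Sum>k\<in>F. indicator unit_cell (k + x) *\<^sub>R f x) \<partial>lborel)"
    by simp
  also have "\<dots> = (\<Sum>k\<in>F. \<integral>x. indicator unit_cell (k + x) *\<^sub>R f x \<partial>lborel)"
    by (intro Bochner_Integration.integral_sum)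
       (rule Bochner_Integration.integrable_bound[OF f], auto simp: indicator_def)
  also have "\<dots> = (\<Sum>k\<in>F. \<integral>x. indicator unit_cell x *\<^sub>R f (x - k) \<partial>lborel)"
  proof (rule sum.cong[OF refl])
    fix k
    show "(\<integral>x. indicator unit_cell (k + x) *\<^sub>R f x \<partial>lborel)
        = (\<integral>x. indicator unit_cell x *\<^sub>R f (x - k) \<partial>lborel)"
      using lborel_integral_translate[of "\<lambda>x. indicator unit_cell x *\<^sub>R f (x - k)" k] by simp
  qed
  also have "\<dots> = (\<integral>x. (\<Sum>k\<in>F. indicator unit_cell x *\<^sub>R f (x - k)) \<partial>lborel)"
  proof (rule Bochner_Integration.integral_sum[symmetric])
    fix k
    have "integrable lborel (\<lambda>x. f (x - k))"
      using lborel_integrable_translate[OF f, of "- k"] by simp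
    then show "integrable lborel (\<lambda>x. indicator unit_cell x *\<^sub>R f (x - k))"
      by (rule Bochner_Integration.integrable_bound) (auto simp: indicator_def)
  qed
  finally show ?thesis by (simp add: set_lebesgue_integral_def scaleR_sum_right)
qed

text \<open>Translation by a vector \<open>a\<close> with \<open>n \<bullet> a = 1 / 2\<close>
  changes the sign of the character. Periodicity makes the integral over a shifted cell equal to
  that over the cell, so the integral is its own negative.\<close>

lemma integral_unit_cell_cis:
  assumes "n \<in> integer_lattice" "n \<noteq> 0"
  shows "(LINT x:unit_cell|lborel. cis (2 * pi * (n \<bullet> x))) = 0"
proof -
  let ?I = "LINT x:unit_cell|lborel. cis (2 * pi * (n \<bullet> x))"
  obtain i where i: "n $ i \<noteq> 0" using assms(2) by (auto simp: vec_eq_iff)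
  define a :: "real ^ 'a" where "a = axis i (1 / (2 * n $ i))"
  have na: "n \<bullet> a = 1 / 2" using i by (simp add: a_def inner_axis)
  define f where "f x = indicator unit_cell (x - a) *\<^sub>R cis (2 * pi * (n \<bullet> x))" for x
  have int0: "integrable lborel (\<lambda>x. indicator unit_cell x *\<^sub>R cis (2 * pi * (n \<bullet> x)))"
  proof (rule Bochner_Integration.integrable_bound)
    show "integrable lborel (\<lambda>x. indicator (cbox 0 1) x *\<^sub>R (1 :: real))"
      by (rule borel_integrable_compact) auto
    show "AE x in lborel. norm (indicator unit_cell x *\<^sub>R cis (2 * pi * (n \<bullet> x)))
        \<le> norm (indicator (cbox 0 1) x *\<^sub>R (1 :: real))"
      by (intro AE_I2) (auto simp: indicator_def unit_cell_def mem_box_cart less_imp_le)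
  qed (measurable, auto simp: cis_conv_exp)
  have shift: "f (a + x) = - (indicator unit_cell x *\<^sub>R cis (2 * pi * (n \<bullet> x)))" for x
  proof -
    have "cis (2 * pi * (n \<bullet> (a + x))) = cis pi * cis (2 * pi * (n \<bullet> x))"
      unfolding cis_mult by (simp add: inner_add_right na distrib_left)
    then show ?thesis by (simp add: f_def cis_pi)
  qed
  have [measurable]: "f \<in> borel_measurable borel" unfolding f_def cis_conv_exp by measurable
  have fI: "(\<integral>x. f x \<partial>lborel) = - ?I"
    using lborel_integral_translate[of f a] by (simp add: shift set_lebesgue_integral_def)
  have fint: "integrable lborel f"
  proof -
    have "integrable lborel (\<lambda>x. f (a + x))" using int0 by (simp add: shift)
    from lborel_integrable_translate[OF this, of "- a"] show ?thesis by simp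
  qed
  define F :: "(real^'a) set" where "F = {k \<in> integer_lattice. norm k \<le> norm a + 2 * CARD('a)}"
  have cell_norm: "norm x \<le> CARD('a)" if "x \<in> unit_cell" for x :: "real^'a"
    using norm_le_card_times[of x 1] that by (auto simp: unit_cell_def less_imp_le)
  have supp: "k \<in> F" if x: "x - a \<in> unit_cell" and k: "k \<in> integer_lattice" "x + k \<in> unit_cell" for x k
  proof -
    have "norm k = norm ((x + k) - (x - a) - a)" by simp
    also have "\<dots> \<le> norm (x + k) + norm (x - a) + norm a"
      by (meson norm_triangle_ineq4 add_right_mono order_trans)
    finally show ?thesis using cell_norm[OF x] cell_norm[OF k(2)] k(1) by (simp add: F_def)
  qed
  have "(\<integral>x. f x \<partial>lborel) = (LINT x:unit_cell|lborel. (\<Sum>k\<in>F. f (x - k)))"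
  proof (rule integral_eq_unit_cell_sum[OF fint])
    show "finite F" unfolding F_def by (rule finite_integer_lattice_norm_le)
    show "k \<in> F" if "f x \<noteq> 0" "k \<in> integer_lattice" "x + k \<in> unit_cell" for x k
      using that supp by (auto simp: f_def indicator_def split: if_splits)
  qed (auto simp: F_def)
  also have "\<dots> = ?I"
  proof (rule set_lebesgue_integral_cong)
    show "\<forall>x. x \<in> unit_cell \<longrightarrow> (\<Sum>k\<in>F. f (x - k)) = cis (2 * pi * (n \<bullet> x))"
    proof safe
      fix x :: "real^'a" assume x: "x \<in> unit_cell"
      obtain k0 where k0: "k0 \<in> integer_lattice" "(x - a) + k0 \<in> unit_cell"
        and uniq: "\<And>k. k \<in> integer_lattice \<Longrightarrow> (x - a) + k \<in> unit_cell \<Longrightarrow> k = k0"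
        using ex1_lattice_translate_unit_cell[of "x - a"] by blast
      have k0F: "- k0 \<in> F"
        using supp[of "x + k0" "- k0"] x k0 integer_lattice_uminus[OF k0(1)]
        by (simp add: algebra_simps)
      have "(\<Sum>k\<in>F. f (x - k)) = (\<Sum>k\<in>{- k0}. f (x - k))"
      proof (rule sum.mono_neutral_right)
        show "\<forall>k\<in>F - {- k0}. f (x - k) = 0"
        proof
          fix k assume k: "k \<in> F - {- k0}"
          have "x - k - a \<notin> unit_cell"
          proof
            assume "x - k - a \<in> unit_cell"
            then have "- k = k0" using uniq[of "- k"] k integer_lattice_uminus
              by (auto simp: F_def algebra_simps)
            then show False using k by auto
          qed
          then show "f (x - k) = 0" by (simp add: f_def)
        qed
      qed (use k0F in \<open>auto simp: F_def finite_integer_lattice_norm_le\<close>)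
      also have "\<dots> = cis (2 * pi * (n \<bullet> (x - (- k0))))"
        using k0 by (simp add: f_def algebra_simps)
      also have "\<dots> = cis (2 * pi * (n \<bullet> x))"
        by (intro cis_inner_lattice_shift assms(1) integer_lattice_uminus k0)
      finally show "(\<Sum>k\<in>F. f (x - k)) = cis (2 * pi * (n \<bullet> x))" .
    qed
  qed simp
  finally have "- ?I = ?I" using fI by simp
  then show ?thesis by (simp add: equation_minus_iff)
qed

section \<open>Fourier coefficients of the periodised indicator\<close>

lemma mem_scaled_copy: "v \<in> scaled_copy \<Omega> x r \<longleftrightarrow> (\<exists>w\<in>\<Omega>. v = x + r *\<^sub>R w)"
  by (auto simp: scaled_copy_def)

text \<open>For \<open>x\<close> in the cube and \<open>r \<le> 1\<close> the scaled copy is bounded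
  uniformly, so one finite set of shifts serves all \<open>x\<close> and \<open>r\<close>. Since
  \<open>z\<close> is an arbitrary representative, the cutoff also depends on
  \<open>norm z\<close>.\<close>

lemma periodic_indicator_eq_sum:
  fixes \<Omega> :: "(real ^ 'n::finite) set" and R :: real
  assumes R: "\<And>w. w \<in> \<Omega> \<Longrightarrow> norm w \<le> R" and x: "x \<in> cbox 0 1" and r: "0 \<le> r" "r \<le> 1"
    and B: "norm z + CARD('n) + \<bar>R\<bar> \<le> B"
  shows "periodic_indicator (scaled_copy \<Omega> x r) z
    = (\<Sum>k\<in>{k \<in> integer_lattice. norm k \<le> B}. indicator (scaled_copy \<Omega> x r) (z + k))"
  unfolding periodic_indicator_def
proof (subst infsum_finite[symmetric, OF finite_integer_lattice_norm_le], rule infsum_cong_neutral)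
  fix k :: "real ^ 'n"
  assume k: "k \<in> integer_lattice - {k \<in> integer_lattice. norm k \<le> B}"
  show "(indicator (scaled_copy \<Omega> x r) (z + k) :: real) = 0"
  proof (rule ccontr)
    assume "(indicator (scaled_copy \<Omega> x r) (z + k) :: real) \<noteq> 0"
    then obtain w where w: "w \<in> \<Omega>" "z + k = x + r *\<^sub>R w"
      by (auto simp: indicator_def mem_scaled_copy split: if_splits)
    have "norm x \<le> CARD('n)"
      using norm_le_card_times[of x 1] x by (auto simp: mem_box_cart)
    moreover have "norm (r *\<^sub>R w) \<le> \<bar>R\<bar>"
    proof -
      have "norm (r *\<^sub>R w) \<le> norm w" using r by (simp add: mult_left_le_one_le)
      then show ?thesis using R[OF w(1)] by linarith
    qed
    moreover have "norm k \<le> norm x + norm (r *\<^sub>R w) + norm z"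
    proof -
      have "x + r *\<^sub>R w - z = k" using w(2) by (simp add: algebra_simps)
      then show ?thesis
        using norm_triangle_ineq4[of "x + r *\<^sub>R w" z] norm_triangle_ineq[of x "r *\<^sub>R w"]
        by (simp only:)
    qed
    ultimately show False using k B by auto
  qed
qed auto

lemma lborel_integral_affine:
  fixes f :: "'a::euclidean_space \<Rightarrow> 'b::{banach, second_countable_topology}"
  assumes [measurable]: "f \<in> borel_measurable borel" and "c \<noteq> 0"
  shows "(\<integral>x. f x \<partial>lborel) = \<bar>c\<bar> ^ DIM('a) *\<^sub>R (\<integral>x. f (t + c *\<^sub>R x) \<partial>lborel)"
proof -
  have "(\<integral>x. f x \<partial>lborel)
      = (\<integral>x. f x \<partial>density (distr lborel borel (\<lambda>x. t + c *\<^sub>R x)) (\<lambda>_. \<bar>c\<bar>^DIM('a)))"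
    using lborel_affine[OF assms(2), of t] by simp
  also have "\<dots> = (\<integral>x. \<bar>c\<bar>^DIM('a) *\<^sub>R f x \<partial>distr lborel borel (\<lambda>x. t + c *\<^sub>R x))"
    by (rule integral_density) auto
  also have "\<dots> = (\<integral>x. \<bar>c\<bar>^DIM('a) *\<^sub>R f (t + c *\<^sub>R x) \<partial>lborel)"
    by (rule integral_distr) auto
  finally show ?thesis by simp
qed

text \<open>Shifting the argument of the indicator can be traded for shifting \<open>x\<close>,
  which leaves the character unchanged. Unfolding then gives an integral over
  \<open>z - r \<Omega>\<close>, and the substitution \<open>y = z - r w\<close> produces the factor
  \<open>r ^ d\<close> and the phase at \<open>z\<close>.\<close>

lemma periodic_indicator_fourier_coefficient:
  fixes \<Omega> :: "(real ^ 'n::finite) set"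
  assumes \<Omega>: "compact \<Omega>" and m: "m \<in> integer_lattice" and r: "0 < r" "r \<le> 1"
  shows "(LINT x:cbox 0 1|lborel.
      periodic_indicator (scaled_copy \<Omega> x r) z *\<^sub>R cis (- (2 * pi * (m \<bullet> x))))
    = cis (- (2 * pi * (m \<bullet> z))) * (r ^ CARD('n) *\<^sub>R (LINT w:\<Omega>|lborel. cis (2 * pi * r * (m \<bullet> w))))"
proof -
  obtain R where R: "\<And>w. w \<in> \<Omega> \<Longrightarrow> norm w \<le> R"
    using compact_imp_bounded[OF \<Omega>] by (auto simp: bounded_iff)
  define F :: "(real^'n) set"
    where "F = {k \<in> integer_lattice. norm k \<le> norm z + CARD('n) + \<bar>R\<bar>}"
  define f where "f y = (indicator (scaled_copy \<Omega> y r) z :: real) *\<^sub>R cis (- (2 * pi * (m \<bullet> y)))" for y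
  have f_alt: "f y = indicator ((\<lambda>w. z - r *\<^sub>R w) ` \<Omega>) y *\<^sub>R cis (- (2 * pi * (m \<bullet> y)))" for y
    unfolding f_def by (rule arg_cong2[where f = scaleR])
      (auto simp: indicator_def mem_scaled_copy image_iff algebra_simps)
  have fint: "integrable lborel f"
    unfolding f_alt[abs_def] cis_conv_exp
    by (intro borel_integrable_compact compact_continuous_image \<Omega> continuous_intros)
  then have fm: "f \<in> borel_measurable borel" using borel_measurable_integrable by fastforce
  have supp: "k \<in> F" if f: "f y \<noteq> 0" and k: "k \<in> integer_lattice" "y + k \<in> unit_cell" for y k
  proof -
    obtain w where w: "w \<in> \<Omega>" "y = z - r *\<^sub>R w"
      using f by (auto simp: f_alt indicator_def split: if_splits)
    have "norm (y + k) \<le> CARD('n)"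
      using norm_le_card_times[of "y + k" 1] k(2) by (auto simp: unit_cell_def less_imp_le)
    moreover have "norm (r *\<^sub>R w) \<le> \<bar>R\<bar>"
    proof -
      have "norm (r *\<^sub>R w) \<le> norm w" using r by (simp add: mult_left_le_one_le)
      then show ?thesis using R[OF w(1)] by linarith
    qed
    moreover have "norm k \<le> norm (y + k) + norm (r *\<^sub>R w) + norm z"
    proof -
      have "(y + k) + r *\<^sub>R w - z = k" using w(2) by simp
      then show ?thesis
        using norm_triangle_ineq4[of "(y + k) + r *\<^sub>R w" z]
          norm_triangle_ineq[of "y + k" "r *\<^sub>R w"]
        by (simp only:)
    qed
    ultimately show ?thesis using k(1) by (auto simp: F_def)
  qed
  have "(LINT x:cbox 0 1|lborel.
      periodic_indicator (scaled_copy \<Omega> x r) z *\<^sub>R cis (- (2 * pi * (m \<bullet> x))))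
    = (LINT x:cbox 0 1|lborel. (\<Sum>k\<in>F. f (x - k)))"
  proof (rule set_lebesgue_integral_cong)
    show "\<forall>x. x \<in> cbox 0 1 \<longrightarrow>
      periodic_indicator (scaled_copy \<Omega> x r) z *\<^sub>R cis (- (2 * pi * (m \<bullet> x))) = (\<Sum>k\<in>F. f (x - k))"
    proof safe
      fix x :: "real^'n" assume x: "x \<in> cbox 0 1"
      have "(\<Sum>k\<in>F. f (x - k)) = (\<Sum>k\<in>F. indicator (scaled_copy \<Omega> x r) (z + k)
          *\<^sub>R cis (- (2 * pi * (m \<bullet> x))))"
      proof (rule sum.cong[OF refl])
        fix k assume "k \<in> F"
        then have "cis (2 * pi * ((- m) \<bullet> (x - k))) = cis (2 * pi * ((- m) \<bullet> x))"
          by (intro cis_inner_lattice_shift integer_lattice_uminus m) (auto simp: F_def)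
        moreover have "(indicator (scaled_copy \<Omega> (x - k) r) z :: real)
            = indicator (scaled_copy \<Omega> x r) (z + k)"
          by (auto simp: indicator_def mem_scaled_copy algebra_simps)
        ultimately show "f (x - k) = indicator (scaled_copy \<Omega> x r) (z + k)
          *\<^sub>R cis (- (2 * pi * (m \<bullet> x)))" by (simp add: f_def)
      qed
      then show "periodic_indicator (scaled_copy \<Omega> x r) z *\<^sub>R cis (- (2 * pi * (m \<bullet> x)))
          = (\<Sum>k\<in>F. f (x - k))"
        using periodic_indicator_eq_sum[OF R x, where r = r and z = z and B = "norm z + CARD('n) + \<bar>R\<bar>"] r
        by (simp add: F_def scaleR_sum_left)
    qed
  qed simp
  also have "\<dots> = (LINT x:unit_cell|lborel. (\<Sum>k\<in>F. f (x - k)))"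
    by (rule set_integral_unit_cell)
       (intro borel_measurable_sum measurable_compose[OF _ fm], simp)
  also have "\<dots> = (\<integral>x. f x \<partial>lborel)"
    using supp by (intro integral_eq_unit_cell_sum[symmetric] fint)
      (auto simp: F_def finite_integer_lattice_norm_le)
  also have "\<dots> = r ^ CARD('n) *\<^sub>R (\<integral>w. f (z + (- r) *\<^sub>R w) \<partial>lborel)"
    using lborel_integral_affine[OF fm, of "- r" z] r by simp
  also have "(\<lambda>w. f (z + (- r) *\<^sub>R w))
      = (\<lambda>w. cis (- (2 * pi * (m \<bullet> z))) * (indicator \<Omega> w *\<^sub>R cis (2 * pi * r * (m \<bullet> w))))"
  proof
    fix w
    have "(indicator (scaled_copy \<Omega> (z + (- r) *\<^sub>R w) r) z :: real) = indicator \<Omega> w"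
      using r by (auto simp: indicator_def mem_scaled_copy)
    then show "f (z + (- r) *\<^sub>R w)
      = cis (- (2 * pi * (m \<bullet> z))) * (indicator \<Omega> w *\<^sub>R cis (2 * pi * r * (m \<bullet> w)))"
      by (simp add: f_def cis_mult inner_diff_right algebra_simps)
  qed
  also have "(\<integral>w. cis (- (2 * pi * (m \<bullet> z))) * (indicator \<Omega> w *\<^sub>R cis (2 * pi * r * (m \<bullet> w))) \<partial>lborel)
      = cis (- (2 * pi * (m \<bullet> z))) * (LINT w:\<Omega>|lborel. cis (2 * pi * r * (m \<bullet> w)))"
    unfolding set_lebesgue_integral_def by (rule integral_mult_right_zero)
  finally show ?thesis by (simp only: mult_scaleR_right)
qed

section \<open>Bessel's inequality\<close>

text \<open>Integrate the nonnegative function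
  \<open>\<bar>f - \<Sum> c i * \<phi> i\<bar> ^ 2\<close>. Norms at most 1 suffice in place of an
  orthonormal system, because the quadratic term in the \<open>c i\<close> is needed only from
  above.\<close>

lemma bessel_inequality:
  fixes f :: "'a \<Rightarrow> complex" and \<phi> :: "'i \<Rightarrow> 'a \<Rightarrow> complex"
  assumes "finite I" and f: "integrable M (\<lambda>x. (cmod (f x))\<^sup>2)"
    and f\<phi>: "\<And>i. i \<in> I \<Longrightarrow> integrable M (\<lambda>x. f x * cnj (\<phi> i x))"
    and \<phi>\<phi>: "\<And>i j. i \<in> I \<Longrightarrow> j \<in> I \<Longrightarrow> integrable M (\<lambda>x. \<phi> i x * cnj (\<phi> j x))"
    and orth: "\<And>i j. i \<in> I \<Longrightarrow> j \<in> I \<Longrightarrow> i \<noteq> j \<Longrightarrow> (\<integral>x. \<phi> i x * cnj (\<phi> j x) \<partial>M) = 0"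
    and norm: "\<And>i. i \<in> I \<Longrightarrow> (\<integral>x. (cmod (\<phi> i x))\<^sup>2 \<partial>M) \<le> 1"
  shows "(\<Sum>i\<in>I. (cmod (\<integral>x. f x * cnj (\<phi> i x) \<partial>M))\<^sup>2) \<le> (\<integral>x. (cmod (f x))\<^sup>2 \<partial>M)"
proof -
  define c where "c i = (\<integral>x. f x * cnj (\<phi> i x) \<partial>M)" for i
  let ?G = "\<lambda>x. \<Sum>i\<in>I. cnj (c i) * (f x * cnj (\<phi> i x))"
  let ?H = "\<lambda>x. \<Sum>i\<in>I. \<Sum>j\<in>I. (c i * cnj (c j)) * (\<phi> i x * cnj (\<phi> j x))"
  have G: "integrable M ?G" and H: "integrable M ?H"
    by (intro Bochner_Integration.integrable_sum integrable_mult_right f\<phi> \<phi>\<phi>; assumption)+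
  have "(\<integral>x. ?G x \<partial>M) = (\<Sum>i\<in>I. cnj (c i) * c i)"
    by (simp add: Bochner_Integration.integral_sum integrable_mult_right f\<phi> c_def)
  also have "\<dots> = complex_of_real (\<Sum>i\<in>I. (cmod (c i))\<^sup>2)"
    unfolding of_real_sum complex_norm_square by (simp only: mult.commute)
  finally have iG: "(\<integral>x. ?G x \<partial>M) = complex_of_real (\<Sum>i\<in>I. (cmod (c i))\<^sup>2)" .
  have "(\<integral>x. ?H x \<partial>M) = (\<Sum>i\<in>I. \<Sum>j\<in>I. (c i * cnj (c j)) * (\<integral>x. \<phi> i x * cnj (\<phi> j x) \<partial>M))"
    by (simp add: Bochner_Integration.integral_sum Bochner_Integration.integrable_sum
        integrable_mult_right \<phi>\<phi>)
  also have "\<dots> = (\<Sum>i\<in>I. (c i * cnj (c i)) * (\<integral>x. \<phi> i x * cnj (\<phi> i x) \<partial>M))"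
  proof (rule sum.cong[OF refl])
    fix i assume i: "i \<in> I"
    have "(\<Sum>j\<in>I. (c i * cnj (c j)) * (\<integral>x. \<phi> i x * cnj (\<phi> j x) \<partial>M))
        = (\<Sum>j\<in>{i}. (c i * cnj (c j)) * (\<integral>x. \<phi> i x * cnj (\<phi> j x) \<partial>M))"
      by (rule sum.mono_neutral_right) (use assms(1) i orth in auto)
    then show "(\<Sum>j\<in>I. (c i * cnj (c j)) * (\<integral>x. \<phi> i x * cnj (\<phi> j x) \<partial>M))
        = (c i * cnj (c i)) * (\<integral>x. \<phi> i x * cnj (\<phi> i x) \<partial>M)" by simp
  qed
  also have "\<dots> = complex_of_real (\<Sum>i\<in>I. (cmod (c i))\<^sup>2 * (\<integral>x. (cmod (\<phi> i x))\<^sup>2 \<partial>M))"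
    unfolding complex_norm_square[symmetric] integral_complex_of_real by simp
  finally have iH: "Re (\<integral>x. ?H x \<partial>M) \<le> (\<Sum>i\<in>I. (cmod (c i))\<^sup>2)"
    using norm by (auto intro!: sum_mono mult_left_le)
  have split: "(\<integral>x. u x - 2 * Re (v x) + Re (w x) \<partial>M)
      = (\<integral>x. u x \<partial>M) - 2 * Re (\<integral>x. v x \<partial>M) + Re (\<integral>x. w x \<partial>M)"
    if "integrable M u" "integrable M v" "integrable M w" for u and v w :: "'a \<Rightarrow> complex"
    using that by simp
  have "0 \<le> (\<integral>x. (cmod (f x))\<^sup>2 - 2 * Re (?G x) + Re (?H x) \<partial>M)"
  proof (rule Bochner_Integration.integral_nonneg_AE, rule AE_I2)
    fix x
    let ?F = "\<Sum>i\<in>I. c i * \<phi> i x"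
    have "complex_of_real ((cmod (f x - ?F))\<^sup>2)
        = (f x) * cnj (f x) - (f x * cnj ?F + cnj (f x * cnj ?F)) + ?F * cnj ?F"
      unfolding complex_norm_square by (simp add: algebra_simps)
    also have "f x * cnj ?F = ?G x" by (simp add: sum_distrib_left mult_ac)
    also have "?F * cnj ?F = ?H x" by (simp add: sum_product mult_ac)
    also have "f x * cnj (f x) = complex_of_real ((cmod (f x))\<^sup>2)" by (rule complex_norm_square[symmetric])
    finally have "Re (complex_of_real ((cmod (f x - ?F))\<^sup>2))
      = Re (complex_of_real ((cmod (f x))\<^sup>2) - (?G x + cnj (?G x)) + ?H x)" by (rule arg_cong)
    also have "\<dots> = (cmod (f x))\<^sup>2 - 2 * Re (?G x) + Re (?H x)"
      unfolding plus_complex.sel minus_complex.sel cnj.sel Re_complex_of_real by simp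
    finally have "(cmod (f x - ?F))\<^sup>2 = (cmod (f x))\<^sup>2 - 2 * Re (?G x) + Re (?H x)"
      unfolding Re_complex_of_real .
    then show "0 \<le> (cmod (f x))\<^sup>2 - 2 * Re (?G x) + Re (?H x)" by (metis zero_le_power2)
  qed
  also have "\<dots> = (\<integral>x. (cmod (f x))\<^sup>2 \<partial>M) - 2 * Re (\<integral>x. ?G x \<partial>M) + Re (\<integral>x. ?H x \<partial>M)"
    by (rule split[OF f G H])
  finally show ?thesis using iG iH by (simp add: c_def)
qed

section \<open>Exponential sums\<close>

lemma norm_sum_cis_squared:
  "complex_of_real ((cmod (\<Sum>x\<in>X. cis (\<theta> x)))\<^sup>2) = (\<Sum>x\<in>X. \<Sum>y\<in>X. cis (\<theta> x - \<theta> y))"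
  unfolding complex_norm_square by (simp add: sum_product cis_cnj cis_mult)

definition exp_sum :: "nat \<Rightarrow> (nat \<Rightarrow> 'a::real_inner) \<Rightarrow> 'a \<Rightarrow> complex" where
  "exp_sum N z m = (\<Sum>j=1..N. cis (- (2 * pi * (m \<bullet> z j))))"

text \<open>Both sides are the same fourfold sum of characters at
  \<open>(a - b) \<bullet> (z l - z j)\<close>, grouped once by frequencies and once by points. On
  the right every term is nonnegative, which is the source of the Cassels-Montgomery bound.\<close>

lemma sum_exp_sum_differences:
  fixes A :: "'a::real_inner set"
  shows "(\<Sum>a\<in>A. \<Sum>b\<in>A. (cmod (exp_sum N z (a - b)))\<^sup>2)
    = (\<Sum>j=1..N. \<Sum>l=1..N. (cmod (\<Sum>a\<in>A. cis (2 * pi * (a \<bullet> (z l - z j)))))\<^sup>2)"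
proof -
  let ?e = "\<lambda>a b j l. cis (2 * pi * ((a - b) \<bullet> (z l - z j)))"
  have "complex_of_real (\<Sum>a\<in>A. \<Sum>b\<in>A. (cmod (exp_sum N z (a - b)))\<^sup>2)
      = (\<Sum>a\<in>A. \<Sum>b\<in>A. \<Sum>j=1..N. \<Sum>l=1..N. ?e a b j l)"
    unfolding of_real_sum exp_sum_def norm_sum_cis_squared
    by (intro sum.cong refl arg_cong[where f = cis]) (simp add: inner_diff_right algebra_simps)
  also have "\<dots> = (\<Sum>a\<in>A. \<Sum>j=1..N. \<Sum>b\<in>A. \<Sum>l=1..N. ?e a b j l)"
    by (rule sum.cong[OF refl], rule sum.swap)
  also have "\<dots> = (\<Sum>j=1..N. \<Sum>a\<in>A. \<Sum>b\<in>A. \<Sum>l=1..N. ?e a b j l)"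
    by (rule sum.swap)
  also have "\<dots> = (\<Sum>j=1..N. \<Sum>a\<in>A. \<Sum>l=1..N. \<Sum>b\<in>A. ?e a b j l)"
    by (rule sum.cong[OF refl], rule sum.cong[OF refl], rule sum.swap)
  also have "\<dots> = (\<Sum>j=1..N. \<Sum>l=1..N. \<Sum>a\<in>A. \<Sum>b\<in>A. ?e a b j l)"
    by (rule sum.cong[OF refl], rule sum.swap)
  also have "\<dots> = complex_of_real
      (\<Sum>j=1..N. \<Sum>l=1..N. (cmod (\<Sum>a\<in>A. cis (2 * pi * (a \<bullet> (z l - z j)))))\<^sup>2)"
    unfolding of_real_sum norm_sum_cis_squared
    by (intro sum.cong refl arg_cong[where f = cis]) (simp add: inner_diff_left algebra_simps)
  finally show ?thesis by (simp only: of_real_eq_iff)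
qed

text \<open>The left-hand side weights each frequency by its number of representations as a difference
  in \<open>A\<close>; on the right-hand side of the preceding identity the diagonal terms are kept.\<close>

lemma sum_exp_sum_nonzero_differences_ge:
  fixes A :: "'a::real_inner set"
  assumes A: "finite A" and N: "N \<ge> 1" "2 * N \<le> card A"
  shows "(\<Sum>m\<in>{a - b | a b. a \<in> A \<and> b \<in> A} - {0}. (cmod (exp_sum N z m))\<^sup>2)
    \<ge> real N * real (card A) / 2"
proof -
  let ?D = "{a - b | a b. a \<in> A \<and> b \<in> A} - {0}"
  let ?S = "\<lambda>m. (cmod (exp_sum N z m))\<^sup>2"
  let ?n = "real (card A)"
  have "finite ((\<lambda>(a, b). a - b) ` (A \<times> A))" using A by simp
  moreover have "?D \<subseteq> (\<lambda>(a, b). a - b) ` (A \<times> A)" by auto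
  ultimately have fD: "finite ?D" by (rule rev_finite_subset)
  have "real N * ?n\<^sup>2 = (\<Sum>j=1..N. (cmod (\<Sum>a\<in>A. cis (2 * pi * (a \<bullet> (z j - z j)))))\<^sup>2)"
    by simp
  also have "\<dots> \<le> (\<Sum>j=1..N. \<Sum>l=1..N. (cmod (\<Sum>a\<in>A. cis (2 * pi * (a \<bullet> (z l - z j)))))\<^sup>2)"
    by (intro sum_mono member_le_sum) auto
  also have "\<dots> = (\<Sum>a\<in>A. \<Sum>b\<in>A. ?S (a - b))" by (rule sum_exp_sum_differences[symmetric])
  \<comment> \<open>For fixed \<open>a\<close> the differences \<open>a - b\<close> with
    \<open>b \<noteq> a\<close> are distinct and nonzero, so each row is at most the full sum over
    nonzero differences plus the zero frequency, which contributes \<open>N ^ 2\<close>.\<close>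
  also have "\<dots> \<le> (\<Sum>a\<in>A. (real N)\<^sup>2 + (\<Sum>m\<in>?D. ?S m))"
  proof (rule sum_mono)
    fix a assume a: "a \<in> A"
    have "(\<Sum>b\<in>A. ?S (a - b)) = ?S 0 + (\<Sum>b\<in>A - {a}. ?S (a - b))"
      using sum.remove[OF A a, of "\<lambda>b. ?S (a - b)"] by simp
    also have "?S 0 = (real N)\<^sup>2" by (simp add: exp_sum_def)
    also have "(\<Sum>b\<in>A - {a}. ?S (a - b)) = (\<Sum>m\<in>(\<lambda>b. a - b) ` (A - {a}). ?S m)"
      by (subst sum.reindex) (auto simp: inj_on_def)
    also have "\<dots> \<le> (\<Sum>m\<in>?D. ?S m)" using fD a by (intro sum_mono2) auto
    finally show "(\<Sum>b\<in>A. ?S (a - b)) \<le> (real N)\<^sup>2 + (\<Sum>m\<in>?D. ?S m)" by simp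
  qed
  also have "\<dots> = ?n * ((real N)\<^sup>2 + (\<Sum>m\<in>?D. ?S m))" by simp
  finally have "?n * (real N * ?n) \<le> ?n * ((real N)\<^sup>2 + (\<Sum>m\<in>?D. ?S m))"
    by (simp add: power2_eq_square mult_ac)
  moreover have n: "?n > 0" using N by simp
  ultimately have "real N * ?n \<le> (real N)\<^sup>2 + (\<Sum>m\<in>?D. ?S m)" by simp
  \<comment> \<open>The factor 2 in \<open>2 * N \<le> card A\<close> lets half of the diagonal
    contribution absorb the zero frequency.\<close>
  moreover have "(real N)\<^sup>2 \<le> real N * ?n / 2"
  proof -
    have "real N * (2 * real N) \<le> real N * ?n" using N(2) by (intro mult_left_mono) linarith+
    then show ?thesis by (simp add: power2_eq_square)
  qed
  ultimately show ?thesis by linarith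
qed

section \<open>Cubes of frequencies and their differences\<close>

definition frequency_box :: "nat \<Rightarrow> (real ^ 'n::finite) set" where
  "frequency_box K = {a. \<forall>i. \<exists>k<K. a $ i = real k}"

lemma frequency_box_eq_image:
  "frequency_box K = (\<lambda>g. \<chi> i. real (g i)) ` (PiE (UNIV :: 'n::finite set) (\<lambda>_. {..<K}))"
proof
  show "frequency_box K \<subseteq> (\<lambda>g. \<chi> i. real (g i)) ` (PiE (UNIV :: 'n set) (\<lambda>_. {..<K}))"
  proof
    fix a :: "real ^ 'n" assume "a \<in> frequency_box K"
    then obtain g where "\<And>i. g i < K \<and> a $ i = real (g i)"
      unfolding frequency_box_def by (auto simp: choice_iff)
    then show "a \<in> (\<lambda>g. \<chi> i. real (g i)) ` (PiE (UNIV :: 'n set) (\<lambda>_. {..<K}))"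
      by (intro image_eqI[of _ _ g]) (auto simp: vec_eq_iff)
  qed
qed (auto simp: frequency_box_def)

lemma finite_frequency_box: "finite (frequency_box K)"
  unfolding frequency_box_eq_image by (intro finite_imageI finite_PiE) auto

lemma card_frequency_box: "card (frequency_box K :: (real ^ 'n::finite) set) = K ^ CARD('n)"
  unfolding frequency_box_eq_image
  by (subst card_image) (auto simp: inj_on_def vec_eq_iff fun_eq_iff card_PiE)

lemma frequency_box_difference:
  fixes a b :: "real ^ 'n::finite"
  assumes "a \<in> frequency_box K" "b \<in> frequency_box K"
  shows "a - b \<in> integer_lattice" "norm (a - b) \<le> CARD('n) * K"
proof -
  have i: "\<exists>k<K. a $ i = real k" "\<exists>k<K. b $ i = real k" for i
    using assms by (auto simp: frequency_box_def)
  show "a - b \<in> integer_lattice"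
  proof -
    have "a $ i \<in> \<int>" "b $ i \<in> \<int>" for i using i[of i] by auto
    then show ?thesis by (simp add: integer_lattice_def)
  qed
  have "\<bar>(a - b) $ i\<bar> \<le> real K" for i using i[of i] by auto
  then have "(\<Sum>i\<in>UNIV. \<bar>(a - b) $ i\<bar>) \<le> (\<Sum>i\<in>(UNIV::'n set). real K)" by (intro sum_mono)
  then show "norm (a - b) \<le> CARD('n) * K"
    using norm_le_l1_cart[of "a - b"] by simp
qed

lemma norm_ge_1_integer_lattice:
  fixes m :: "real ^ 'n::finite"
  assumes "m \<in> integer_lattice" "m \<noteq> 0"
  shows "norm m \<ge> 1"
proof -
  obtain i where i: "m $ i \<noteq> 0" using assms(2) by (auto simp: vec_eq_iff)
  obtain k :: int where k: "m $ i = of_int k" using assms(1) by (auto simp: integer_lattice_def elim: Ints_cases)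
  have "\<bar>m $ i\<bar> \<ge> 1" using i by (simp add: k)
  then show ?thesis using component_le_norm_cart[of m i] by linarith
qed

section \<open>Fourier coefficients of the discrepancy\<close>

lemma integrable_indicator_times_bounded:
  fixes h :: "'a::euclidean_space \<Rightarrow> 'b::{banach, second_countable_topology}"
  assumes "compact Q" and [measurable]: "h \<in> borel_measurable borel"
    and B: "\<And>y. y \<in> Q \<Longrightarrow> norm (h y) \<le> B"
  shows "integrable lborel (\<lambda>y. indicator Q y *\<^sub>R h y)"
proof (rule Bochner_Integration.integrable_bound)
  have [measurable]: "Q \<in> sets borel" using assms(1) by (simp add: borel_compact)
  show "integrable lborel (\<lambda>y. indicator Q y *\<^sub>R B)"
    by (rule borel_integrable_compact[OF assms(1)]) simp
  show "AE y in lborel. norm (indicator Q y *\<^sub>R h y) \<le> norm (indicator Q y *\<^sub>R B)"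
    using B by (intro AE_I2) (auto simp: indicator_def abs_if intro: order_trans[OF B])
  show "(\<lambda>y. indicator Q y *\<^sub>R h y) \<in> borel_measurable lborel" by measurable
qed

text \<open>The periodised indicator reduces to a fixed finite sum only over the cube and for
  \<open>r\<close> in the unit interval. A Borel function \<open>D\<close> agreeing with the
  discrepancy there provides the joint measurability that Fubini and Bessel rely on.\<close>

lemma discrepancy_eq_borel_measurable_bounded:
  fixes \<Omega> :: "(real ^ 'n::finite) set"
  assumes \<Omega>: "compact \<Omega>"
  shows "\<exists>D B. D \<in> borel_measurable borel \<and>
    (\<forall>x\<in>cbox 0 1. \<forall>r\<in>{0..1}. D (x, r) = discrepancy \<Omega> N z x r) \<and>
    (\<forall>y\<in>cbox 0 1 \<times> {0..1}. \<bar>D y\<bar> \<le> B)"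
proof -
  obtain R where R: "\<And>w. w \<in> \<Omega> \<Longrightarrow> norm w \<le> R"
    using compact_imp_bounded[OF \<Omega>] by (auto simp: bounded_iff)
  define F :: "nat \<Rightarrow> (real ^ 'n) set"
    where "F j = {k \<in> integer_lattice. norm k \<le> norm (z j) + CARD('n) + \<bar>R\<bar>}" for j
  \<comment> \<open>The set of pairs \<open>(x, r)\<close> for which \<open>z j + k\<close> lies in
    \<open>x + r \<Omega>\<close>, written as a continuous image of a compact set so that it is
    Borel.\<close>
  define C :: "nat \<Rightarrow> real ^ 'n \<Rightarrow> ((real ^ 'n) \<times> real) set"
    where "C j k = (\<lambda>(w, r). (z j + k - r *\<^sub>R w, r)) ` (\<Omega> \<times> {0..1})" for j k
  define D where "D y = (\<Sum>j=1..N. \<Sum>k\<in>F j. indicator (C j k) y)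
    - real N * snd y ^ CARD('n) * measure lebesgue \<Omega>" for y
  have "compact (C j k)" for j k
    unfolding C_def split_def
    by (intro compact_continuous_image compact_Times \<Omega> compact_Icc continuous_intros)
  then have C_borel: "C j k \<in> sets borel" for j k by (simp add: borel_compact)
  have eq: "D (x, r) = discrepancy \<Omega> N z x r" if x: "x \<in> cbox 0 1" and r: "r \<in> {0..1}" for x r
  proof -
    have "(indicator (C j k) (x, r) :: real) = indicator (scaled_copy \<Omega> x r) (z j + k)" for j k
      using r by (force simp: C_def indicator_def mem_scaled_copy image_iff algebra_simps)
    then show ?thesis
      using r by (simp add: D_def discrepancy_def F_def
          periodic_indicator_eq_sum[OF R x, where B = "norm (z j) + CARD('n) + \<bar>R\<bar>" and z = "z j" for j])
  qed
  have bd: "\<bar>D y\<bar> \<le> (\<Sum>j=1..N. real (card (F j))) + real N * measure lebesgue \<Omega>"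
    if "y \<in> cbox 0 1 \<times> {0..1}" for y
  proof -
    have "\<bar>D y\<bar> \<le> \<bar>\<Sum>j=1..N. \<Sum>k\<in>F j. indicator (C j k) y :: real\<bar>
        + \<bar>real N * snd y ^ CARD('n) * measure lebesgue \<Omega>\<bar>"
      unfolding D_def by (rule abs_triangle_ineq4)
    also have "\<bar>\<Sum>j=1..N. \<Sum>k\<in>F j. indicator (C j k) y :: real\<bar> \<le> (\<Sum>j=1..N. real (card (F j)))"
    proof -
      have "(\<Sum>k\<in>F j. indicator (C j k) y :: real) \<le> (\<Sum>k\<in>F j. 1)" for j
        by (intro sum_mono) (simp add: indicator_def)
      then show ?thesis by (auto simp: abs_of_nonneg sum_nonneg intro!: sum_mono)
    qed
    also have "\<bar>real N * snd y ^ CARD('n) * measure lebesgue \<Omega>\<bar> \<le> real N * measure lebesgue \<Omega>"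
      using that by (auto simp: abs_mult mem_Times_iff power_le_one mult_left_le
          intro!: mult_right_mono)
    finally show ?thesis by simp
  qed
  have main_term: "(\<lambda>y::(real ^ 'n) \<times> real. real N * snd y ^ CARD('n) * measure lebesgue \<Omega>)
      \<in> borel_measurable borel"
    by (intro borel_measurable_continuous_onI continuous_intros)
  have "D \<in> borel_measurable borel"
    unfolding D_def
    by (rule borel_measurable_diff[OF _ main_term])
       (intro borel_measurable_sum borel_measurable_indicator C_borel)
  then show ?thesis using eq bd by blast
qed

text \<open>At a nonzero frequency the main term, constant in \<open>x\<close>, integrates to zero,
  so only the coefficients of the periodised indicators remain, and these share one factor depending
  on \<open>\<Omega>\<close>.\<close>

lemma discrepancy_fourier_coefficient:
  fixes \<Omega> :: "(real ^ 'n::finite) set"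
  assumes \<Omega>: "compact \<Omega>" and m: "m \<in> integer_lattice" "m \<noteq> 0" and r: "0 < r" "r \<le> 1"
  shows "(LINT x:cbox 0 1|lborel. discrepancy \<Omega> N z x r *\<^sub>R cis (- (2 * pi * (m \<bullet> x))))
    = exp_sum N z m * (r ^ CARD('n) *\<^sub>R (LINT w:\<Omega>|lborel. cis (2 * pi * r * (m \<bullet> w))))"
proof -
  let ?e = "\<lambda>x. cis (- (2 * pi * (m \<bullet> x)))"
  obtain R where R: "\<And>w. w \<in> \<Omega> \<Longrightarrow> norm w \<le> R"
    using compact_imp_bounded[OF \<Omega>] by (auto simp: bounded_iff)
  have cint: "set_integrable lborel (cbox 0 1) (\<lambda>x. c *\<^sub>R ?e x)" for c :: real
    unfolding set_integrable_def cis_conv_exp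
    by (intro borel_integrable_compact compact_cbox continuous_intros)
  have pint: "set_integrable lborel (cbox 0 1)
      (\<lambda>x. periodic_indicator (scaled_copy \<Omega> x r) (z j) *\<^sub>R ?e x)" for j
  proof -
    define F :: "(real ^ 'n) set"
      where "F = {k \<in> integer_lattice. norm k \<le> norm (z j) + CARD('n) + \<bar>R\<bar>}"
    define C where "C k = (\<lambda>w. z j + k - r *\<^sub>R w) ` \<Omega>" for k
    have "compact (C k)" for k
      unfolding C_def by (intro compact_continuous_image \<Omega> continuous_intros)
    then have [measurable]: "C k \<in> sets borel" for k by (simp add: borel_compact)
    have [measurable]: "?e \<in> borel_measurable borel"
      unfolding cis_conv_exp by (intro borel_measurable_continuous_onI continuous_intros)
    have "(\<lambda>x. indicator (C k) x *\<^sub>R ?e x) \<in> borel_measurable borel" for k by measurable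
    then have "integrable lborel (\<lambda>x. indicator (cbox 0 1) x *\<^sub>R (indicator (C k) x *\<^sub>R ?e x))" for k
      by (intro integrable_indicator_times_bounded[where B = 1]) (auto simp: indicator_def)
    then have "set_integrable lborel (cbox 0 1) (\<lambda>x. \<Sum>k\<in>F. indicator (C k) x *\<^sub>R ?e x)"
      unfolding set_integrable_def scaleR_sum_right by (intro Bochner_Integration.integrable_sum) blast
    moreover have "(\<Sum>k\<in>F. indicator (C k) x *\<^sub>R ?e x)
        = periodic_indicator (scaled_copy \<Omega> x r) (z j) *\<^sub>R ?e x" if x: "x \<in> cbox 0 1" for x
    proof -
      have "(indicator (C k) x :: real) = indicator (scaled_copy \<Omega> x r) (z j + k)" for k
        by (auto simp: C_def indicator_def mem_scaled_copy image_iff algebra_simps)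
      then show ?thesis
        using r by (simp add: F_def scaleR_sum_left
            periodic_indicator_eq_sum[OF R x, where B = "norm (z j) + CARD('n) + \<bar>R\<bar>"])
    qed
    ultimately show ?thesis by (subst set_integrable_cong[OF refl refl]) auto
  qed
  have "(LINT x:cbox 0 1|lborel. ?e x) = (LINT x:unit_cell|lborel. ?e x)"
    by (rule set_integral_unit_cell)
       (auto simp: cis_conv_exp intro!: borel_measurable_continuous_onI continuous_intros)
  also have "\<dots> = 0"
    using integral_unit_cell_cis[OF integer_lattice_uminus[OF m(1)]] m(2) by simp
  finally have e0: "(LINT x:cbox 0 1|lborel. ?e x) = 0" .
  define c where "c = real N * r ^ CARD('n) * measure lebesgue \<Omega>"
  have "(LINT x:cbox 0 1|lborel. discrepancy \<Omega> N z x r *\<^sub>R ?e x)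
      = (LINT x:cbox 0 1|lborel. (\<Sum>j=1..N. periodic_indicator (scaled_copy \<Omega> x r) (z j) *\<^sub>R ?e x)
          - c *\<^sub>R ?e x)"
    by (simp add: discrepancy_def c_def scaleR_diff_left scaleR_sum_left)
  also have "\<dots> = (LINT x:cbox 0 1|lborel. (\<Sum>j=1..N. periodic_indicator (scaled_copy \<Omega> x r) (z j) *\<^sub>R ?e x))
      - (LINT x:cbox 0 1|lborel. c *\<^sub>R ?e x)"
  proof (rule set_integral_diff(2)[OF _ cint])
    show "set_integrable lborel (cbox 0 1)
        (\<lambda>x. \<Sum>j=1..N. periodic_indicator (scaled_copy \<Omega> x r) (z j) *\<^sub>R ?e x)"
      using pint unfolding set_integrable_def scaleR_sum_right
      by (intro Bochner_Integration.integrable_sum) blast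
  qed
  also have "(LINT x:cbox 0 1|lborel. c *\<^sub>R ?e x) = 0"
    using e0 by simp
  also have "(LINT x:cbox 0 1|lborel. (\<Sum>j=1..N. periodic_indicator (scaled_copy \<Omega> x r) (z j) *\<^sub>R ?e x))
      = (\<Sum>j=1..N. LINT x:cbox 0 1|lborel. periodic_indicator (scaled_copy \<Omega> x r) (z j) *\<^sub>R ?e x)"
    using pint unfolding set_integrable_def set_lebesgue_integral_def scaleR_sum_right
    by (intro Bochner_Integration.integral_sum) blast
  also have "\<dots> = exp_sum N z m * (r ^ CARD('n) *\<^sub>R (LINT w:\<Omega>|lborel. cis (2 * pi * r * (m \<bullet> w))))"
    by (simp only: periodic_indicator_fourier_coefficient[OF \<Omega> m(1) r] exp_sum_def sum_distrib_right)
  finally show ?thesis by simp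
qed

section \<open>Lower bounds for the Fourier weights\<close>

text \<open>Fubini: doing the radial integral first turns an average of Fourier transforms of
  \<open>\<Omega>\<close> into an integral over \<open>\<Omega>\<close> of a function of
  \<open>m \<bullet> w - \<beta>\<close> alone, where pointwise positivity can be used.\<close>

lemma osc_integral_swap:
  fixes \<Omega> :: "'a::euclidean_space set"
  assumes \<Omega>: "compact \<Omega>"
  shows "(LINT r:{0..1}|lborel. poly f r *\<^sub>R
      (cis (- (2 * pi * \<beta> * r)) * (LINT w:\<Omega>|lborel. cis (2 * pi * r * (m \<bullet> w)))))
    = (LINT w:\<Omega>|lborel. osc_integral f (2 * pi * (m \<bullet> w - \<beta>)))" (is ?eq)
    and "set_integrable lborel \<Omega> (\<lambda>w. osc_integral f (2 * pi * (m \<bullet> w - \<beta>)))" (is ?int)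
proof -
  define h where "h w r = indicator \<Omega> w *\<^sub>R (indicator {0..1} r *\<^sub>R
    (poly f r *\<^sub>R cis (2 * pi * (m \<bullet> w - \<beta>) * r)))" for w r
  have "continuous_on UNIV (poly f)" by (intro continuous_intros)
  then have pc: "continuous_on S (\<lambda>y::'a \<times> real. poly f (snd y))" for S
    by (intro continuous_on_compose2[of UNIV "poly f" S snd] continuous_intros) auto
  have "integrable lborel (\<lambda>y. indicator (\<Omega> \<times> {0..1}) y *\<^sub>R
      (poly f (snd y) *\<^sub>R cis (2 * pi * (m \<bullet> fst y - \<beta>) * snd y)))"
    unfolding cis_conv_exp
    by (intro borel_integrable_compact compact_Times \<Omega> compact_Icc continuous_intros pc)
  also have "(\<lambda>y. indicator (\<Omega> \<times> {0..1}) y *\<^sub>R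
      (poly f (snd y) *\<^sub>R cis (2 * pi * (m \<bullet> fst y - \<beta>) * snd y))) = case_prod h"
    by (auto simp: h_def indicator_def fun_eq_iff)
  finally have int: "integrable (lborel \<Otimes>\<^sub>M lborel) (case_prod h)" by (simp add: lborel_prod)
  have inner_r: "(\<integral>r. h w r \<partial>lborel) = indicator \<Omega> w *\<^sub>R osc_integral f (2 * pi * (m \<bullet> w - \<beta>))" for w
    by (simp add: h_def osc_integral_def set_lebesgue_integral_def del: scaleR_scaleR)
  have inner_w: "(\<integral>w. h w r \<partial>lborel) = indicator {0..1} r *\<^sub>R (poly f r *\<^sub>R
      (cis (- (2 * pi * \<beta> * r)) * (LINT w:\<Omega>|lborel. cis (2 * pi * r * (m \<bullet> w)))))" for r
  proof -
    have "h w r = (indicator {0..1} r *\<^sub>R poly f r *\<^sub>R cis (- (2 * pi * \<beta> * r))) *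
        (indicator \<Omega> w *\<^sub>R cis (2 * pi * r * (m \<bullet> w)))" for w
      unfolding h_def by (simp add: cis_mult algebra_simps)
    then have "(\<integral>w. h w r \<partial>lborel) = (indicator {0..1} r *\<^sub>R poly f r *\<^sub>R cis (- (2 * pi * \<beta> * r))) *
        (LINT w:\<Omega>|lborel. cis (2 * pi * r * (m \<bullet> w)))"
      unfolding set_lebesgue_integral_def by (simp only: integral_mult_right_zero)
    then show ?thesis by simp
  qed
  have "(\<integral>r. (\<integral>w. h w r \<partial>lborel) \<partial>lborel) = (\<integral>w. (\<integral>r. h w r \<partial>lborel) \<partial>lborel)"
    by (rule lborel_pair.Fubini_integral[OF int])
  then show ?eq unfolding inner_r inner_w set_lebesgue_integral_def .
  show ?int
    using lborel_pair.integrable_fst[OF int] unfolding inner_r set_integrable_def .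
qed

text \<open>The real part of the integrand is nonnegative on all of \<open>\<Omega>\<close>, so the
  integral is at least its part over the cap of height \<open>s1 / norm m\<close>, where the
  integrand is at least \<open>c0\<close>. The cap estimate then gives the power of
  \<open>norm m\<close>.\<close>

lemma osc_weight_lower_bound:
  fixes \<Omega> :: "'a::euclidean_space set"
  assumes \<Omega>: "convex_body \<Omega>" "smooth_hypersurface (frontier \<Omega>)" and p: "p + 1 = 4 * (d::nat)"
  shows "\<exists>C>0. \<forall>m. norm m \<ge> 1 \<longrightarrow> (\<exists>\<beta>.
    (cmod (LINT w:\<Omega>|lborel. osc_integral (bump_poly p) (2 * pi * (m \<bullet> w - \<beta>))))\<^sup>2
      \<ge> C / norm m ^ (DIM('a) + 1))"
proof -
  have comp: "compact \<Omega>" using \<Omega>(1) by (simp add: convex_body_def)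
  obtain T where T: "T > 0"
    "\<And>t. t \<ge> T \<Longrightarrow> Re (osc_integral (bump_poly p) t) \<ge> 1 / (2 * t ^ (p + 1))"
    using osc_integral_bump_poly_pos[OF p] by blast
  obtain s c where s: "s > 0" and c: "c > 0" and cap: "\<And>m::'a. m \<noteq> 0 \<Longrightarrow>
      \<exists>a\<in>\<Omega>. (\<forall>w\<in>\<Omega>. m \<bullet> a \<le> m \<bullet> w) \<and> (\<forall>h. 0 < h \<and> h \<le> s \<longrightarrow>
        (measure lebesgue {w\<in>\<Omega>. m \<bullet> (w - a) \<le> norm m * h})\<^sup>2 \<ge> c * h ^ (DIM('a) + 1))"
    using cap_measure_lower_bound[OF \<Omega>] by blast
  define c0 where "c0 = 1 / (2 * (T + 1) ^ (p + 1))"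
  have c0: "c0 > 0" using T by (simp add: c0_def)
  \<comment> \<open>On the cap the argument of \<open>osc_integral\<close> exceeds \<open>T\<close>
    by at most \<open>2 * pi * s1\<close>, hence stays between \<open>T\<close> and
    \<open>T + 1\<close>, which is where \<open>c0\<close> comes from.\<close>
  define s1 where "s1 = min s (1 / (2 * pi))"
  have s1: "s1 > 0" "s1 \<le> s" "2 * pi * s1 \<le> 1"
  proof -
    have "2 * pi * s1 \<le> 2 * pi * (1 / (2 * pi))" unfolding s1_def by (intro mult_left_mono) auto
    then show "2 * pi * s1 \<le> 1" by simp
  qed (use s in \<open>auto simp: s1_def\<close>)
  have "\<exists>\<beta>. (cmod (LINT w:\<Omega>|lborel. osc_integral (bump_poly p) (2 * pi * (m \<bullet> w - \<beta>))))\<^sup>2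
      \<ge> (c0\<^sup>2 * c * s1 ^ (DIM('a) + 1)) / norm m ^ (DIM('a) + 1)"
    if m: "norm m \<ge> 1" for m :: 'a
  proof -
    have m0: "m \<noteq> 0" using m by auto
    define h where "h = s1 / norm m"
    have "s1 \<le> s * norm m" using mult_mono[OF s1(2) m] s by simp
    then have h: "0 < h" "h \<le> s" "norm m * h = s1"
      using s1 m m0 by (auto simp: h_def field_simps)
    obtain a where a: "a \<in> \<Omega>" "\<And>w. w \<in> \<Omega> \<Longrightarrow> m \<bullet> a \<le> m \<bullet> w"
      and ca: "(measure lebesgue {w\<in>\<Omega>. m \<bullet> (w - a) \<le> norm m * h})\<^sup>2 \<ge> c * h ^ (DIM('a) + 1)"
      using cap[OF m0] h by blast
    \<comment> \<open>Chosen so that the argument equals \<open>T\<close> at the minimiser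
      \<open>a\<close> and is at least \<open>T\<close> throughout \<open>\<Omega>\<close>.\<close>
    define \<beta> where "\<beta> = m \<bullet> a - T / (2 * pi)"
    let ?t = "\<lambda>w. 2 * pi * (m \<bullet> w - \<beta>)"
    have t: "?t w = T + 2 * pi * (m \<bullet> (w - a))" for w
      by (simp add: \<beta>_def inner_diff_right field_simps)
    have tT: "?t w \<ge> T" if "w \<in> \<Omega>" for w
      using a(2)[OF that] by (simp add: t inner_diff_right)
    let ?osc = "\<lambda>w. osc_integral (bump_poly p) (?t w)"
    let ?K = "{w\<in>\<Omega>. m \<bullet> (w - a) \<le> norm m * h}"
    have "?K = \<Omega> \<inter> {w. m \<bullet> (w - a) \<le> norm m * h}" by blast
    moreover have "closed {w. m \<bullet> (w - a) \<le> norm m * h}"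
      by (intro closed_Collect_le continuous_intros)
    ultimately have Kc: "compact ?K" using comp by (simp add: compact_Int_closed)
    have pos: "Re (?osc w) \<ge> 0" if "w \<in> \<Omega>" for w
    proof -
      have "0 \<le> 1 / (2 * t ^ (p + 1))" if "T \<le> t" for t using that T(1) by simp
      from this[OF tT[OF that]]
      show ?thesis using T(2)[OF tT[OF that]] by linarith
    qed
    have big: "Re (?osc w) \<ge> c0" if w: "w \<in> ?K" for w
    proof -
      have "2 * pi * (m \<bullet> (w - a)) \<le> 2 * pi * s1" using w h(3) by (intro mult_left_mono) auto
      then have "?t w \<le> T + 1" using s1(3) by (simp only: t)
      moreover have tw: "T \<le> ?t w" using w tT by blast
      ultimately have "?t w ^ (p + 1) \<le> (T + 1) ^ (p + 1)" using T(1) by (intro power_mono) auto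
      moreover have "?t w ^ (p + 1) > 0" using tw T(1) by (intro zero_less_power) linarith
      ultimately have "c0 \<le> 1 / (2 * ?t w ^ (p + 1))"
        unfolding c0_def by (intro divide_left_mono mult_pos_pos) auto
      then show ?thesis using T(2)[OF tw] by linarith
    qed
    have int: "integrable lborel (\<lambda>w. indicator \<Omega> w *\<^sub>R ?osc w)"
      using osc_integral_swap(2)[OF comp] by (simp add: set_integrable_def)
    have "c0 * measure lebesgue ?K = (\<integral>w. indicator ?K w *\<^sub>R c0 \<partial>lborel)"
      using Kc by (simp add: borel_compact mult.commute)
    also have "\<dots> \<le> (\<integral>w. Re (indicator \<Omega> w *\<^sub>R ?osc w) \<partial>lborel)"
    proof (rule integral_mono)
      show "integrable lborel (\<lambda>w. indicator ?K w *\<^sub>R c0)"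
        by (rule borel_integrable_compact[OF Kc]) simp
      show "integrable lborel (\<lambda>w. Re (indicator \<Omega> w *\<^sub>R ?osc w))"
        by (rule integrable_Re[OF int])
      fix w
      show "indicator ?K w *\<^sub>R c0 \<le> Re (indicator \<Omega> w *\<^sub>R ?osc w)"
        using big[of w] pos[of w] by (auto simp: indicator_def)
    qed
    also have "\<dots> = Re (LINT w:\<Omega>|lborel. ?osc w)"
      unfolding set_lebesgue_integral_def by (rule integral_Re[OF int])
    also have "\<dots> \<le> cmod (LINT w:\<Omega>|lborel. ?osc w)" by (rule complex_Re_le_cmod)
    finally have "(c0 * measure lebesgue ?K)\<^sup>2 \<le> (cmod (LINT w:\<Omega>|lborel. ?osc w))\<^sup>2"
      using c0 by (intro power_mono) auto
    moreover have "c0\<^sup>2 * (c * h ^ (DIM('a) + 1)) \<le> (c0 * measure lebesgue ?K)\<^sup>2"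
      unfolding power_mult_distrib using ca by (intro mult_left_mono) auto
    ultimately have "c0\<^sup>2 * (c * h ^ (DIM('a) + 1)) \<le> (cmod (LINT w:\<Omega>|lborel. ?osc w))\<^sup>2"
      by (rule order_trans[rotated])
    then show ?thesis by (intro exI[of _ \<beta>]) (simp only: h_def power_divide times_divide_eq_right mult.assoc)
  qed
  moreover have "c0\<^sup>2 * c * s1 ^ (DIM('a) + 1) > 0" using c0 c s1 by (intro mult_pos_pos) auto
  ultimately show ?thesis by blast
qed

section \<open>Test functions\<close>

text \<open>The radial factor is \<open>bump_poly p\<close> divided by \<open>r ^ d\<close>, the Jacobian of the dilation by \<open>r\<close>.\<close>

definition test_function :: "nat \<Rightarrow> real \<Rightarrow> real ^ 'n \<Rightarrow> (real ^ 'n::finite) \<times> real \<Rightarrow> complex" where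
  "test_function p \<beta> m y = indicator (cbox 0 1 \<times> {0..1}) y *\<^sub>R
    ((snd y ^ (p - CARD('n)) * (1 - snd y) ^ (p + 2)) *\<^sub>R cis (2 * pi * (m \<bullet> fst y + \<beta> * snd y)))"

lemma radial_factor_bound:
  fixes r :: real
  assumes "0 \<le> r" "r \<le> 1"
  shows "\<bar>r ^ a * (1 - r) ^ b\<bar> \<le> 1"
  using assms by (auto simp: abs_mult power_le_one intro!: mult_le_one)

lemma integrable_test_function_products:
  "integrable lborel (\<lambda>y. test_function p \<beta> m y * cnj (test_function p \<beta>' m' y))"
proof -
  have "integrable lborel (\<lambda>y. indicator (cbox 0 1 \<times> {0..1}) y *\<^sub>R
    (((snd y ^ (p - CARD('a)) * (1 - snd y) ^ (p + 2)) *\<^sub>R cis (2 * pi * (m \<bullet> fst y + \<beta> * snd y))) *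
     cnj ((snd y ^ (p - CARD('a)) * (1 - snd y) ^ (p + 2)) *\<^sub>R cis (2 * pi * (m' \<bullet> fst y + \<beta>' * snd y)))))"
    unfolding cis_conv_exp
    by (intro borel_integrable_compact compact_Times compact_cbox compact_Icc continuous_intros)
  moreover have "test_function p \<beta> m y * cnj (test_function p \<beta>' m' y) =
    indicator (cbox 0 1 \<times> {0..1}) y *\<^sub>R
    (((snd y ^ (p - CARD('a)) * (1 - snd y) ^ (p + 2)) *\<^sub>R cis (2 * pi * (m \<bullet> fst y + \<beta> * snd y))) *
     cnj ((snd y ^ (p - CARD('a)) * (1 - snd y) ^ (p + 2)) *\<^sub>R cis (2 * pi * (m' \<bullet> fst y + \<beta>' * snd y))))"
    for y
    by (simp add: test_function_def indicator_def)
  ultimately show ?thesis by simp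
qed

lemma lborel_integral_prod_snd:
  fixes F :: "'a::euclidean_space \<times> 'b::euclidean_space \<Rightarrow> 'c::{banach, second_countable_topology}"
  assumes "integrable lborel F"
  shows "(\<integral>y. F y \<partial>lborel) = (\<integral>r. (\<integral>x. F (x, r) \<partial>lborel) \<partial>lborel)"
proof -
  have "integrable (lborel \<Otimes>\<^sub>M lborel) (case_prod (\<lambda>x r. F (x, r)))"
    using assms by (simp add: lborel_prod)
  from lborel_pair.integral_snd[OF this] show ?thesis by (simp add: lborel_prod)
qed

lemma lborel_integral_prod_fst:
  fixes F :: "'a::euclidean_space \<times> 'b::euclidean_space \<Rightarrow> 'c::{banach, second_countable_topology}"
  assumes "integrable lborel F"
  shows "(\<integral>y. F y \<partial>lborel) = (\<integral>x. (\<integral>r. F (x, r) \<partial>lborel) \<partial>lborel)"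
proof -
  have "integrable (lborel \<Otimes>\<^sub>M lborel) (case_prod (\<lambda>x r. F (x, r)))"
    using assms by (simp add: lborel_prod)
  from lborel_pair.integral_fst[OF this] show ?thesis by (simp add: lborel_prod)
qed

text \<open>For each \<open>r\<close> the integral over \<open>x\<close> already vanishes. The
  modulations \<open>\<beta>\<close> and \<open>\<beta>'\<close> only contribute a factor
  independent of \<open>x\<close>, which is why they may be chosen separately for each
  frequency.\<close>

lemma test_functions_orthogonal:
  fixes m m' :: "real ^ 'n::finite"
  assumes "m \<in> integer_lattice" "m' \<in> integer_lattice" "m \<noteq> m'"
  shows "(\<integral>y. test_function p \<beta> m y * cnj (test_function p \<beta>' m' y) \<partial>lborel) = 0"
proof -
  have "(LINT x:cbox 0 1|lborel. cis (2 * pi * ((m - m') \<bullet> x)))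
      = (LINT x:unit_cell|lborel. cis (2 * pi * ((m - m') \<bullet> x)))"
    by (rule set_integral_unit_cell)
       (auto simp: cis_conv_exp intro!: borel_measurable_continuous_onI continuous_intros)
  also have "\<dots> = 0"
    using assms by (intro integral_unit_cell_cis integer_lattice_diff) auto
  finally have zero: "(\<integral>x. indicator (cbox 0 1) x *\<^sub>R cis (2 * pi * ((m - m') \<bullet> x)) \<partial>lborel) = 0"
    by (simp add: set_lebesgue_integral_def)
  have "test_function p \<beta> m (x, r) * cnj (test_function p \<beta>' m' (x, r))
      = (((r ^ (p - CARD('n)) * (1 - r) ^ (p + 2))\<^sup>2 * indicator {0..1} r) *\<^sub>R cis (2 * pi * ((\<beta> - \<beta>') * r)))
        * (indicator (cbox 0 1) x *\<^sub>R cis (2 * pi * ((m - m') \<bullet> x)))" for x r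
  proof -
    have "cis (2 * pi * (m \<bullet> x + \<beta> * r)) * cnj (cis (2 * pi * (m' \<bullet> x + \<beta>' * r)))
        = cis (2 * pi * ((\<beta> - \<beta>') * r)) * cis (2 * pi * ((m - m') \<bullet> x))"
      unfolding cis_cnj cis_mult by (rule arg_cong[where f = cis])
        (simp add: inner_diff_left algebra_simps)
    then show ?thesis
      by (simp add: test_function_def indicator_def power2_eq_square mult_ac)
  qed
  then have "(\<integral>x. test_function p \<beta> m (x, r) * cnj (test_function p \<beta>' m' (x, r)) \<partial>lborel) = 0" for r
    using zero by (simp only: integral_mult_right_zero mult_zero_right)
  then show ?thesis
    using lborel_integral_prod_snd[OF integrable_test_function_products[of p \<beta> m \<beta>' m']]
    by simp
qed

lemma measure_cbox_unit: "measure lborel (cbox 0 (1 :: real ^ 'n::finite)) = 1"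
proof -
  have "(0 :: real ^ 'n) \<in> cbox 0 1" by (simp add: mem_box_cart)
  then show ?thesis by (subst content_cbox_cart) auto
qed

lemma measure_unit_cylinder:
  "measure lborel (cbox 0 (1 :: real ^ 'n::finite) \<times> {0..1 :: real}) = 1"
proof -
  have "cbox 0 (1 :: real ^ 'n) \<times> {0..1 :: real} = cbox (0, 0) (1, 1)"
    by (simp only: cbox_Pair_eq box_real)
  then show ?thesis by (simp only: content_Pair measure_cbox_unit) simp
qed

lemma norm_test_function_le:
  "(\<integral>y. (cmod (test_function p \<beta> m y))\<^sup>2 \<partial>lborel) \<le> 1"
    for m :: "real ^ 'n::finite"
proof -
  let ?Q = "cbox 0 (1 :: real ^ 'n) \<times> {0..1 :: real}"
  have Q: "compact ?Q" by (intro compact_Times compact_cbox compact_Icc)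
  have iQ: "integrable lborel (\<lambda>y. indicator ?Q y *\<^sub>R (1::real))"
    by (rule borel_integrable_compact[OF Q]) simp
  have "complex_of_real ((cmod (test_function p \<beta> m y))\<^sup>2)
      = test_function p \<beta> m y * cnj (test_function p \<beta> m y)" for y
    by (rule complex_norm_square)
  then have "integrable lborel (\<lambda>y. complex_of_real ((cmod (test_function p \<beta> m y))\<^sup>2))"
    using integrable_test_function_products[of p \<beta> m \<beta> m] by simp
  then have "integrable lborel (\<lambda>y. (cmod (test_function p \<beta> m y))\<^sup>2)"
    by (simp only: complex_of_real_integrable_eq)
  then have "(\<integral>y. (cmod (test_function p \<beta> m y))\<^sup>2 \<partial>lborel)
      \<le> (\<integral>y. indicator ?Q y *\<^sub>R (1::real) \<partial>lborel)"
  proof (rule integral_mono[OF _ iQ])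
    fix y :: "(real ^ 'n) \<times> real"
    have "cmod (test_function p \<beta> m y) \<le> 1" if "y \<in> ?Q"
      using that radial_factor_bound[of "snd y" "p - CARD('n)" "p + 2"]
      by (auto simp: test_function_def)
    then show "(cmod (test_function p \<beta> m y))\<^sup>2 \<le> indicator ?Q y *\<^sub>R (1::real)"
      by (cases "y \<in> ?Q") (auto simp: test_function_def power_le_one)
  qed
  also have "\<dots> = 1"
    using Q by (simp add: borel_compact measure_unit_cylinder)
  finally show ?thesis .
qed

lemma inner_product_test_function:
  fixes \<Omega> :: "(real ^ 'n::finite) set"
  assumes \<Omega>: "compact \<Omega>" and m: "m \<in> integer_lattice" "m \<noteq> 0" and p: "p > CARD('n)"
    and D: "D \<in> borel_measurable borel"
      "\<And>x r. x \<in> cbox 0 1 \<Longrightarrow> r \<in> {0..1} \<Longrightarrow> D (x, r) = discrepancy \<Omega> N z x r"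
      "\<And>y. y \<in> cbox 0 1 \<times> {0..1} \<Longrightarrow> \<bar>D y\<bar> \<le> B"
  shows "integrable lborel (\<lambda>y. (indicator (cbox 0 1 \<times> {0..1}) y *\<^sub>R complex_of_real (D y))
      * cnj (test_function p \<beta> m y))" (is ?int)
    and "(\<integral>y. (indicator (cbox 0 1 \<times> {0..1}) y *\<^sub>R complex_of_real (D y))
      * cnj (test_function p \<beta> m y) \<partial>lborel)
      = exp_sum N z m * (LINT w:\<Omega>|lborel. osc_integral (bump_poly p) (2 * pi * (m \<bullet> w - \<beta>)))" (is ?eq)
proof -
  let ?Q = "cbox 0 (1 :: real ^ 'n) \<times> {0..1 :: real}"
  let ?g = "\<lambda>r::real. r ^ (p - CARD('n)) * (1 - r) ^ (p + 2)"
  let ?F = "\<lambda>y. (indicator ?Q y *\<^sub>R complex_of_real (D y)) * cnj (test_function p \<beta> m y)"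
  let ?u = "\<lambda>y. cnj (?g (snd y) *\<^sub>R cis (2 * pi * (m \<bullet> fst y + \<beta> * snd y)))"
  have "?u \<in> borel_measurable borel"
    unfolding cis_conv_exp by (intro borel_measurable_continuous_onI continuous_intros)
  then have h: "(\<lambda>y. complex_of_real (D y) * ?u y) \<in> borel_measurable borel"
    using D(1) by (intro borel_measurable_times) measurable
  have "integrable lborel (\<lambda>y. indicator ?Q y *\<^sub>R (complex_of_real (D y) * ?u y))"
  proof (rule integrable_indicator_times_bounded[OF _ h])
    fix y assume y: "y \<in> ?Q"
    have "\<bar>?g (snd y)\<bar> \<le> 1" using y by (intro radial_factor_bound) auto
    then have "\<bar>D y\<bar> * \<bar>?g (snd y)\<bar> \<le> B * 1"
      using D(3)[OF y] by (intro mult_mono) auto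
    moreover have "norm (complex_of_real (D y) * ?u y) = \<bar>D y\<bar> * \<bar>?g (snd y)\<bar>"
      unfolding norm_mult by (simp add: norm_mult)
    ultimately show "norm (complex_of_real (D y) * ?u y) \<le> B" by (simp only: mult_1_right)
  qed (intro compact_Times compact_cbox compact_Icc)
  moreover have "indicator ?Q y *\<^sub>R (complex_of_real (D y) * ?u y) = ?F y" for y
    by (simp add: test_function_def indicator_def)
  ultimately show int: ?int by simp
  let ?E = "\<lambda>r. LINT w:\<Omega>|lborel. cis (2 * pi * r * (m \<bullet> w))"
  have inner: "(\<integral>x. ?F (x, r) \<partial>lborel) = exp_sum N z m *
      (indicator {0..1} r *\<^sub>R (poly (bump_poly p) r *\<^sub>R (cis (- (2 * pi * \<beta> * r)) * ?E r)))" for r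
  proof (cases "0 < r \<and> r \<le> 1")
    case True
    have "?F (x, r) = (?g r *\<^sub>R cis (- (2 * pi * \<beta> * r))) *
        (indicator (cbox 0 1) x *\<^sub>R (discrepancy \<Omega> N z x r *\<^sub>R cis (- (2 * pi * (m \<bullet> x)))))" for x
    proof (cases "x \<in> cbox 0 1")
      case x: True
      have "cnj (cis (2 * pi * (m \<bullet> x + \<beta> * r))) = cis (- (2 * pi * \<beta> * r)) * cis (- (2 * pi * (m \<bullet> x)))"
        unfolding cis_cnj cis_mult by (rule arg_cong[where f = cis]) (simp add: algebra_simps)
      then show ?thesis
        using x True D(2)[OF x, of r] by (simp add: test_function_def scaleR_conv_of_real mult_ac)
    qed (simp add: test_function_def)
    then have "(\<integral>x. ?F (x, r) \<partial>lborel) = (?g r *\<^sub>R cis (- (2 * pi * \<beta> * r))) *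
        (LINT x:cbox 0 1|lborel. discrepancy \<Omega> N z x r *\<^sub>R cis (- (2 * pi * (m \<bullet> x))))"
      unfolding set_lebesgue_integral_def by (simp only: integral_mult_right_zero)
    also have "\<dots> = (?g r *\<^sub>R cis (- (2 * pi * \<beta> * r))) * (exp_sum N z m * (r ^ CARD('n) *\<^sub>R ?E r))"
      using True by (simp only: discrepancy_fourier_coefficient[OF \<Omega> m])
    also have "\<dots> = exp_sum N z m * ((r ^ CARD('n) * ?g r) *\<^sub>R (cis (- (2 * pi * \<beta> * r)) * ?E r))"
      by (simp add: scaleR_conv_of_real mult_ac)
    also have "r ^ CARD('n) * ?g r = poly (bump_poly p) r"
      using p by (simp add: poly_bump_poly mult.assoc[symmetric] power_add[symmetric])
    finally show ?thesis using True by simp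
  next
    case False
    have "?F (x, r) = 0" for x
      using False p by (cases "r = 0") (auto simp: test_function_def indicator_def)
    then have "(\<integral>x. ?F (x, r) \<partial>lborel) = 0" by (simp only: Bochner_Integration.integral_zero)
    moreover have "indicator {0..1} r *\<^sub>R poly (bump_poly p) r = 0"
      using False p by (cases "r = 0") (auto simp: poly_bump_poly indicator_def)
    then have "indicator {0..1} r *\<^sub>R (poly (bump_poly p) r *\<^sub>R (cis (- (2 * pi * \<beta> * r)) * ?E r)) = 0"
      by (metis scaleR_scaleR scaleR_zero_left real_scaleR_def)
    ultimately show ?thesis by (simp only: mult_zero_right)
  qed
  have "(\<integral>y. ?F y \<partial>lborel) = (\<integral>r. exp_sum N z m *
      (indicator {0..1} r *\<^sub>R (poly (bump_poly p) r *\<^sub>R (cis (- (2 * pi * \<beta> * r)) * ?E r))) \<partial>lborel)"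
    using lborel_integral_prod_snd[OF int] by (simp only: inner)
  also have "\<dots> = exp_sum N z m * (LINT r:{0..1}|lborel. poly (bump_poly p) r *\<^sub>R
      (cis (- (2 * pi * \<beta> * r)) * ?E r))"
    unfolding set_lebesgue_integral_def by (rule integral_mult_right_zero)
  finally show ?eq by (simp only: osc_integral_swap(1)[OF \<Omega>])
qed

section \<open>The lower bound\<close>

text \<open>If the discrepancy were below \<open>b\<close> for all admissible \<open>x\<close> and
  \<open>r\<close>, its mean square over a domain of measure 1 would be at most
  \<open>b\<^sup>2\<close>. Discarding the null set \<open>r = 0\<close> yields a positive radius.
  The comparison rule asks for integrability of the constant bound only.\<close>

lemma exists_large_discrepancy:
  fixes \<Omega> :: "(real ^ 'n::finite) set"
  assumes "b \<ge> 0" and "b\<^sup>2 < (LINT x:cbox 0 1|lborel. (LINT r:{0..1}|lborel. \<bar>discrepancy \<Omega> N z x r\<bar>\<^sup>2))"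
  shows "\<exists>x r. 0 < r \<and> r \<le> 1 \<and> \<bar>discrepancy \<Omega> N z x r\<bar> \<ge> b"
proof (rule ccontr)
  assume no: "\<nexists>x r. 0 < r \<and> r \<le> 1 \<and> \<bar>discrepancy \<Omega> N z x r\<bar> \<ge> b"
  have r_le: "(LINT r:{0..1}|lborel. \<bar>discrepancy \<Omega> N z x r\<bar>\<^sup>2) \<le> b\<^sup>2" for x
  proof -
    have "(\<integral>r. indicator {0..1} r *\<^sub>R \<bar>discrepancy \<Omega> N z x r\<bar>\<^sup>2 \<partial>lborel)
        \<le> (\<integral>r. indicator {0..1::real} r *\<^sub>R b\<^sup>2 \<partial>lborel)"
    proof (rule integral_mono_AE')
      show "integrable lborel (\<lambda>r. indicator {0..1::real} r *\<^sub>R b\<^sup>2)"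
        by (rule borel_integrable_compact[OF compact_Icc continuous_on_const])
      have "AE r in lborel. r \<noteq> (0::real)" by (rule AE_lborel_singleton)
      then show "AE r in lborel. indicator {0..1} r *\<^sub>R \<bar>discrepancy \<Omega> N z x r\<bar>\<^sup>2
          \<le> indicator {0..1} r *\<^sub>R b\<^sup>2"
      proof eventually_elim
        case (elim r)
        show ?case
        proof (cases "r \<in> {0..1}")
          case True
          then have "0 < r" "r \<le> 1" using elim by auto
          then have "\<bar>discrepancy \<Omega> N z x r\<bar> \<le> b" using no by (meson less_imp_le not_le)
          then have "\<bar>discrepancy \<Omega> N z x r\<bar>\<^sup>2 \<le> b\<^sup>2" by (rule power_mono) simp
          then show ?thesis using True by simp
        qed simp
      qed
    qed (simp add: indicator_def)
    also have "\<dots> = b\<^sup>2" by simp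
    finally show ?thesis by (simp only: set_lebesgue_integral_def)
  qed
  have "(\<integral>x. indicator (cbox 0 1) x *\<^sub>R (LINT r:{0..1}|lborel. \<bar>discrepancy \<Omega> N z x r\<bar>\<^sup>2) \<partial>lborel)
      \<le> (\<integral>x. indicator (cbox 0 (1 :: real ^ 'n)) x *\<^sub>R b\<^sup>2 \<partial>lborel)"
  proof (rule integral_mono_AE')
    show "integrable lborel (\<lambda>x. indicator (cbox 0 (1 :: real ^ 'n)) x *\<^sub>R b\<^sup>2)"
      by (rule borel_integrable_compact[OF compact_cbox continuous_on_const])
  qed (use r_le in \<open>simp_all add: indicator_def\<close>)
  also have "\<dots> = b\<^sup>2" by (simp add: measure_cbox_unit)
  finally show False using assms(2) by (simp add: set_lebesgue_integral_def)
qed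

text \<open>Bessel's inequality on the cylinder of all \<open>(x, r)\<close>: each inner product
  with a test function factors into an exponential sum and a weight depending only on
  \<open>\<Omega>\<close>, \<open>m\<close> and \<open>\<beta> m\<close>.\<close>

lemma spectral_lower_bound:
  fixes \<Omega> :: "(real ^ 'n::finite) set"
  assumes \<Omega>: "compact \<Omega>" and p: "p > CARD('n)" and I: "finite I" "I \<subseteq> integer_lattice - {0}"
  shows "(\<Sum>m\<in>I. (cmod (exp_sum N z m))\<^sup>2 *
      (cmod (LINT w:\<Omega>|lborel. osc_integral (bump_poly p) (2 * pi * (m \<bullet> w - \<beta> m))))\<^sup>2)
    \<le> (LINT x:cbox 0 1|lborel. (LINT r:{0..1}|lborel. \<bar>discrepancy \<Omega> N z x r\<bar>\<^sup>2))"
proof -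
  let ?Q = "cbox 0 (1 :: real ^ 'n) \<times> {0..1 :: real}"
  obtain D B where D: "D \<in> borel_measurable borel"
      "\<And>x r. x \<in> cbox 0 1 \<Longrightarrow> r \<in> {0..1} \<Longrightarrow> D (x, r) = discrepancy \<Omega> N z x r"
      "\<And>y. y \<in> ?Q \<Longrightarrow> \<bar>D y\<bar> \<le> B"
    using discrepancy_eq_borel_measurable_bounded[OF \<Omega>, of N z] by metis
  let ?f = "\<lambda>y. indicator ?Q y *\<^sub>R complex_of_real (D y)"
  have D2: "(\<lambda>y. (D y)\<^sup>2) \<in> borel_measurable borel" using D(1) by measurable
  have "integrable lborel (\<lambda>y. indicator ?Q y *\<^sub>R (D y)\<^sup>2)"
  proof (rule integrable_indicator_times_bounded[OF _ D2])
    fix y assume "y \<in> ?Q"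
    then have "\<bar>D y\<bar>\<^sup>2 \<le> B\<^sup>2" using D(3) by (intro power_mono) auto
    then show "norm ((D y)\<^sup>2) \<le> B\<^sup>2" by simp
  qed (intro compact_Times compact_cbox compact_Icc)
  moreover have fD: "(cmod (?f y))\<^sup>2 = indicator ?Q y *\<^sub>R (D y)\<^sup>2" for y
    by (simp add: indicator_def)
  ultimately have f2: "integrable lborel (\<lambda>y. (cmod (?f y))\<^sup>2)" by simp
  have "(\<Sum>m\<in>I. (cmod (\<integral>y. ?f y * cnj (test_function p (\<beta> m) m y) \<partial>lborel))\<^sup>2)
      \<le> (\<integral>y. (cmod (?f y))\<^sup>2 \<partial>lborel)"
  proof (rule bessel_inequality[OF I(1) f2])
    fix m assume m: "m \<in> I"
    show "integrable lborel (\<lambda>y. ?f y * cnj (test_function p (\<beta> m) m y))"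
      using I(2) m by (intro inner_product_test_function(1)[OF \<Omega> _ _ p D]) auto
    show "(\<integral>y. (cmod (test_function p (\<beta> m) m y))\<^sup>2 \<partial>lborel) \<le> 1"
      by (rule norm_test_function_le)
    fix m' assume m': "m' \<in> I"
    show "integrable lborel (\<lambda>y. test_function p (\<beta> m) m y * cnj (test_function p (\<beta> m') m' y))"
      by (rule integrable_test_function_products)
    assume "m \<noteq> m'"
    then show "(\<integral>y. test_function p (\<beta> m) m y * cnj (test_function p (\<beta> m') m' y) \<partial>lborel) = 0"
      using I(2) m m' by (intro test_functions_orthogonal) auto
  qed
  also have "(\<Sum>m\<in>I. (cmod (\<integral>y. ?f y * cnj (test_function p (\<beta> m) m y) \<partial>lborel))\<^sup>2)
      = (\<Sum>m\<in>I. (cmod (exp_sum N z m))\<^sup>2 *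
      (cmod (LINT w:\<Omega>|lborel. osc_integral (bump_poly p) (2 * pi * (m \<bullet> w - \<beta> m))))\<^sup>2)"
  proof (rule sum.cong[OF refl])
    fix m assume "m \<in> I"
    then have m: "m \<in> integer_lattice" "m \<noteq> 0" using I(2) by auto
    show "(cmod (\<integral>y. ?f y * cnj (test_function p (\<beta> m) m y) \<partial>lborel))\<^sup>2
      = (cmod (exp_sum N z m))\<^sup>2 *
      (cmod (LINT w:\<Omega>|lborel. osc_integral (bump_poly p) (2 * pi * (m \<bullet> w - \<beta> m))))\<^sup>2"
      by (simp only: inner_product_test_function(2)[OF \<Omega> m p D] norm_mult power_mult_distrib)
  qed
  also have "(\<integral>y. (cmod (?f y))\<^sup>2 \<partial>lborel)
      = (\<integral>x. (\<integral>r. (cmod (?f (x, r)))\<^sup>2 \<partial>lborel) \<partial>lborel)"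
    by (rule lborel_integral_prod_fst[OF f2])
  also have "(\<lambda>x. \<integral>r. (cmod (?f (x, r)))\<^sup>2 \<partial>lborel)
      = (\<lambda>x. indicator (cbox 0 1) x *\<^sub>R (LINT r:{0..1}|lborel. \<bar>discrepancy \<Omega> N z x r\<bar>\<^sup>2))"
  proof
    fix x :: "real ^ 'n"
    have "(cmod (?f (x, r)))\<^sup>2
        = indicator (cbox 0 1) x *\<^sub>R (indicator {0..1} r *\<^sub>R \<bar>discrepancy \<Omega> N z x r\<bar>\<^sup>2)" for r
      unfolding fD using D(2) by (auto simp: indicator_def)
    then show "(\<integral>r. (cmod (?f (x, r)))\<^sup>2 \<partial>lborel)
        = indicator (cbox 0 1) x *\<^sub>R (LINT r:{0..1}|lborel. \<bar>discrepancy \<Omega> N z x r\<bar>\<^sup>2)"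
      unfolding set_lebesgue_integral_def by (simp only: integral_scaleR_right)
  qed
  finally show ?thesis by (simp only: set_lebesgue_integral_def[of lborel "cbox 0 1"])
qed

text \<open>Take the ceiling of \<open>(2 * N) powr (1 / d)\<close>. Rounding up at most doubles a
  number that is at least 1, and \<open>2 powr (1 / d) \<le> 2\<close>, which gives the 4.\<close>

lemma exists_frequency_cutoff:
  assumes N: "N \<ge> 1" and d: "d \<ge> (1::nat)"
  shows "\<exists>K::nat. K \<ge> 1 \<and> 2 * N \<le> K ^ d \<and> real K \<le> 4 * real N powr (1 / d)"
proof -
  define K where "K = nat \<lceil>real (2 * N) powr (1 / d)\<rceil>"
  have ge1: "real (2 * N) powr (1 / d) \<ge> 1" using N by (intro ge_one_powr_ge_zero) auto
  have K: "real K \<ge> real (2 * N) powr (1 / d)" "real K \<le> real (2 * N) powr (1 / d) + 1"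
    unfolding K_def using ge1 by linarith+
  have "real (2 * N) = (real (2 * N) powr (1 / d)) ^ d"
    using N d by (simp add: powr_realpow[symmetric] powr_powr)
  also have "\<dots> \<le> real K ^ d" using K(1) by (intro power_mono) auto
  finally have "2 * N \<le> K ^ d" by (metis of_nat_le_iff of_nat_power)
  moreover have "real (2 * N) powr (1 / d) = 2 powr (1 / d) * real N powr (1 / d)"
    by (simp add: powr_mult)
  moreover have "2 powr (1 / d) \<le> (2::real)" using d powr_mono[of "1 / d" 1 2] by simp
  then have "2 powr (1 / d) * real N powr (1 / d) \<le> 2 * real N powr (1 / d)"
    by (rule mult_right_mono) simp
  moreover have "real K \<ge> 1" using K(1) ge1 by linarith
  ultimately show ?thesis using K(2) ge1 by (intro exI[of _ K]) auto
qed

theorem theorem1p3: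
  fixes \<Omega> :: "(real ^ 'n::finite) set"
  assumes "CARD('n) \<ge> 2"
    and "convex_body \<Omega>"
    and "smooth_hypersurface (frontier \<Omega>)"
    and "finite_order_of_contact (frontier \<Omega>)"
  shows "\<exists>c::real. c > 0 \<and>
    (\<forall>N::nat. N \<ge> 1 \<longrightarrow> (\<forall>z :: nat \<Rightarrow> real ^ 'n.
       (LINT x:cbox 0 1|lborel. (LINT r:{0..1}|lborel. \<bar>discrepancy \<Omega> N z x r\<bar>\<^sup>2))
         \<ge> c * real N powr (1 - 1 / real CARD('n)) \<and>
       (\<exists>x :: real ^ 'n. \<exists>r::real. 0 < r \<and> r \<le> 1 \<and>
          \<bar>discrepancy \<Omega> N z x r\<bar> \<ge> c * real N powr (1/2 - 1 / (2 * real CARD('n))))))"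
proof -
  let ?d = "CARD('n)"
  let ?L2 = "\<lambda>N z. LINT x:cbox 0 1|lborel. (LINT r:{0..1}|lborel. \<bar>discrepancy \<Omega> N z x r\<bar>\<^sup>2)"
  have \<Omega>: "compact \<Omega>" using assms(2) by (simp add: convex_body_def)
  \<comment> \<open>This makes \<open>p + 1\<close> a multiple of four, for the sign of the leading
    term, and \<open>p\<close> larger than the dimension, for the division by
    \<open>r ^ d\<close>.\<close>
  define p where "p = 4 * ?d - 1"
  have p: "p + 1 = 4 * ?d" "p > ?d" using assms(1) by (auto simp: p_def)
  obtain C where C: "C > 0" "\<And>m :: real ^ 'n. norm m \<ge> 1 \<Longrightarrow> \<exists>\<beta>.
      (cmod (LINT w:\<Omega>|lborel. osc_integral (bump_poly p) (2 * pi * (m \<bullet> w - \<beta>))))\<^sup>2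
        \<ge> C / norm m ^ (?d + 1)"
    using osc_weight_lower_bound[OF assms(2,3) p(1)] by auto
  then obtain \<beta> where \<beta>: "\<And>m :: real ^ 'n. norm m \<ge> 1 \<Longrightarrow>
      (cmod (LINT w:\<Omega>|lborel. osc_integral (bump_poly p) (2 * pi * (m \<bullet> w - \<beta> m))))\<^sup>2
        \<ge> C / norm m ^ (?d + 1)" by metis
  \<comment> \<open>The weight bound \<open>C / (d * K) ^ (d + 1)\<close> times the mass
    \<open>N * K ^ d / 2\<close> equals \<open>C * N / (2 * d ^ (d + 1) * K)\<close>. Inserting
    \<open>K \<le> 4 * N powr (1 / d)\<close> turns the 2 into 8.\<close>
  define c1 where "c1 = C / (8 * real ?d ^ (?d + 1))"
  have c1: "c1 > 0" using C(1) by (simp add: c1_def)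
  have main: "?L2 N z \<ge> c1 * real N powr (1 - 1 / real ?d)" if N: "N \<ge> 1" for N z
  proof -
    obtain K where K: "K \<ge> 1" "2 * N \<le> K ^ ?d" "real K \<le> 4 * real N powr (1 / ?d)"
      using exists_frequency_cutoff[OF N, of ?d] assms(1) by auto
    let ?A = "frequency_box K :: (real ^ 'n) set"
    have fA: "finite ?A" by (rule finite_frequency_box)
    define I where "I = {a - b | a b. a \<in> ?A \<and> b \<in> ?A} - {0}"
    have "finite ((\<lambda>(a, b). a - b) ` (?A \<times> ?A))" by (intro finite_imageI finite_cartesian_product fA)
    moreover have "I \<subseteq> (\<lambda>(a, b). a - b) ` (?A \<times> ?A)" by (auto simp: I_def)
    ultimately have fI: "finite I" by (rule rev_finite_subset)
    have I: "m \<in> integer_lattice" "m \<noteq> 0" "norm m \<le> ?d * K" if "m \<in> I" for m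
      using that frequency_box_difference by (auto simp: I_def)
    let ?S = "\<lambda>m. (cmod (exp_sum N z m))\<^sup>2"
    let ?c = "C / (?d * K) ^ (?d + 1)"
    have "real N * real (K ^ ?d) / 2 \<le> (\<Sum>m\<in>I. ?S m)"
      using sum_exp_sum_nonzero_differences_ge[OF fA N, of z] K(2)
      unfolding I_def card_frequency_box by blast
    then have "?c * (real N * real (K ^ ?d) / 2) \<le> ?c * (\<Sum>m\<in>I. ?S m)"
      using C(1) by (intro mult_left_mono) auto
    also have "\<dots> = (\<Sum>m\<in>I. ?S m * ?c)"
      unfolding sum_distrib_left by (intro sum.cong refl mult.commute)
    also have "\<dots> \<le> (\<Sum>m\<in>I. ?S m *
      (cmod (LINT w:\<Omega>|lborel. osc_integral (bump_poly p) (2 * pi * (m \<bullet> w - \<beta> m))))\<^sup>2)"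
    proof (intro sum_mono mult_left_mono)
      fix m assume m: "m \<in> I"
      have m1: "norm m \<ge> 1" using norm_ge_1_integer_lattice I[OF m] by blast
      have "norm m ^ (?d + 1) \<le> (?d * K) ^ (?d + 1)"
        using I(3)[OF m] by (simp only: of_nat_power) (intro power_mono, auto)
      then have "?c \<le> C / norm m ^ (?d + 1)"
        using C(1) m1 K(1) by (intro divide_left_mono mult_pos_pos zero_less_power) auto
      then show "?c \<le> (cmod (LINT w:\<Omega>|lborel. osc_integral (bump_poly p) (2 * pi * (m \<bullet> w - \<beta> m))))\<^sup>2"
        using \<beta>[OF m1] by linarith
    qed simp
    also have "\<dots> \<le> ?L2 N z"
      using fI I by (intro spectral_lower_bound[OF \<Omega> p(2)]) auto
    finally have L2: "?c * (real N * real (K ^ ?d) / 2) \<le> ?L2 N z" .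
    have "c1 * real N powr (1 - 1 / ?d) = c1 * (4 * (real N / (4 * real N powr (1 / ?d))))"
      using N by (simp add: powr_diff)
    also have "\<dots> \<le> c1 * (4 * (real N / real K))"
      using c1 K N by (intro mult_left_mono divide_left_mono) auto
    also have "\<dots> = ?c * (real N * real (K ^ ?d) / 2)"
      using K(1) assms(1) by (simp add: c1_def power_mult_distrib field_simps)
    finally show ?thesis using L2 by linarith
  qed
  \<comment> \<open>The single constant has to serve both conclusions. Halving
    \<open>sqrt c1\<close> gives \<open>c\<^sup>2 < c1\<close>, the strict inequality from which a
    point of large discrepancy is extracted.\<close>
  define c where "c = min c1 (sqrt c1 / 2)"
  have c: "c > 0" "c \<le> c1" "c \<le> sqrt c1 / 2" using c1 by (auto simp: c_def)
  show ?thesis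
  proof (intro exI[of _ c] conjI allI impI c(1))
    fix N :: nat and z :: "nat \<Rightarrow> real ^ 'n" assume N: "N \<ge> 1"
    let ?X = "real N powr (1 - 1 / real ?d)"
    have "c * ?X \<le> c1 * ?X" using c by (intro mult_right_mono) auto
    then show "c * ?X \<le> ?L2 N z" using main[OF N, of z] by linarith
    let ?b = "c * real N powr (1/2 - 1 / (2 * real ?d))"
    have "(real N powr (1/2 - 1 / (2 * real ?d)))\<^sup>2 = ?X"
      using N by (simp add: powr_power right_diff_distrib)
    then have "?b\<^sup>2 = c\<^sup>2 * ?X" by (simp add: power_mult_distrib)
    also have "c\<^sup>2 \<le> (sqrt c1 / 2)\<^sup>2" using c by (intro power_mono) auto
    then have "c\<^sup>2 < c1" using c1 by (simp add: power_divide)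
    then have "c\<^sup>2 * ?X < c1 * ?X" using N by (intro mult_strict_right_mono) auto
    finally have "?b\<^sup>2 < ?L2 N z" using main[OF N, of z] by linarith
    then show "\<exists>x r. 0 < r \<and> r \<le> 1 \<and> ?b \<le> \<bar>discrepancy \<Omega> N z x r\<bar>"
      using c(1) by (intro exists_large_discrepancy) auto
  qed
qed

end
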